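(* Consider the standard model: a pseudo billiard in the equilateral unit $d$-dimensional pyramid $\mathcal{X}\subset\mathbb{R}^d$ whose vector field is constant on each $(d-1)$-dimensional face. If for each vertex of $\mathcal{X}$ the straight line drawn through this vertex parallel to the constant vector field corresponding to the opposite $(d-1)$-dimensional face intersects this face in an inner point of the face, then this pseudo billiard system is strongly chaotic. Otherwise a pseudo billiard can have a globally stable periodic trajectory; that is, there exists a standard model for which this condition fails and which has a globally stable periodic trajectory.
   Context: Pseudo billiard in $\mathcal{X}$: a particle moves with constant velocity (of unit modulus) inside $\mathcal{X}$; at the moment of a collision with a $(d-1)$-dimensional face its velocity changes instantaneously to the given constant vector, directed into $\mathcal{X}$, attached to this face. The equilateral unit $d$-dimensional pyramid is the regular $d$-simplex. $X$ is the union of the $(d-1)$-dimensional faces of $\mathcal{X}$ (the union of the $(d-2)$-dimensional faces has zero $(d-1)$-dimensional Lebesgue measure, and at its points one of the adjacent faces is chosen according to a fixed order). The first return (Poincaré) map $T:X\to X$ sends $x\in X$ to the next intersection of the trajectory of $x$ with $X$. The system is strongly chaotic if there is a $T$-invariant measure absolutely continuous with respect to $(d-1)$-dimensional Lebesgue measure on $X$. Periodic trajectories are understood for the map $T$ (a fixed point is included as a special case). *)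

theory Defs
  imports "HOL-Analysis.Analysis" "HOL-Probability.Probability"
begin

text \<open>
  A model is given by the vertices \<open>w 0, \<dots>, w d\<close> of the pyramid in a \<open>d\<close>-dimensional
  Euclidean space and by vectors \<open>v 0, \<dots>, v d\<close>; only the indices up to \<open>d\<close> matter.
  Face \<open>i\<close> is the facet opposite to vertex \<open>w i\<close>, and \<open>v i\<close> is the vector attached to it.
  The fixed order of the faces is the order of their indices; since the vertices may be
  labelled arbitrarily, every linear order of the faces arises in this way.
\<close>

definition pyramid :: "(nat \<Rightarrow> 'a::euclidean_space) \<Rightarrow> 'a set" where
  "pyramid w = convex hull (w ` {..DIM('a)})"

definition face :: "(nat \<Rightarrow> 'a::euclidean_space) \<Rightarrow> nat \<Rightarrow> 'a set" where
  "face w i = convex hull (w ` ({..DIM('a)} - {i}))"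

definition faces_union :: "(nat \<Rightarrow> 'a::euclidean_space) \<Rightarrow> 'a set" where
  "faces_union w = (\<Union>i\<in>{..DIM('a)}. face w i)"

definition directed_into :: "(nat \<Rightarrow> 'a::euclidean_space) \<Rightarrow> 'a \<Rightarrow> 'a \<Rightarrow> bool" where
  "directed_into w x u \<longleftrightarrow>
     eventually (\<lambda>t. x + t *\<^sub>R u \<in> interior (pyramid w)) (at_right (0::real))"

definition standard_model ::
    "(nat \<Rightarrow> 'a::euclidean_space) \<Rightarrow> (nat \<Rightarrow> 'a) \<Rightarrow> bool" where
  "standard_model w v \<longleftrightarrow>
     \<not> affine_dependent (w ` {..DIM('a)}) \<and>
     (\<forall>i\<le>DIM('a). \<forall>j\<le>DIM('a). i \<noteq> j \<longrightarrow> dist (w i) (w j) = 1) \<and>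
     (\<forall>i\<le>DIM('a). norm (v i) = 1 \<and>
        (\<forall>x\<in>rel_interior (face w i). directed_into w x (v i)))"

text \<open>
  In the relative interior of face \<open>i\<close>, only \<open>i\<close> is available.  At a point lying on several
  faces, the vector of an adjacent face may point out of the pyramid although it is directed
  into it at the inner points of that face; such a face admits no motion from that point.
  The fixed order therefore decides between the adjacent faces whose vector is directed
  into the pyramid at the point itself.
\<close>

definition available_faces ::
    "(nat \<Rightarrow> 'a::euclidean_space) \<Rightarrow> (nat \<Rightarrow> 'a) \<Rightarrow> 'a \<Rightarrow> nat set" where
  "available_faces w v x = {i. i \<le> DIM('a) \<and> x \<in> face w i \<and> directed_into w x (v i)}"

definition velocity ::
    "(nat \<Rightarrow> 'a::euclidean_space) \<Rightarrow> (nat \<Rightarrow> 'a) \<Rightarrow> 'a \<Rightarrow> 'a" where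
  "velocity w v x = v (LEAST i. i \<in> available_faces w v x)"

definition flight_time :: "(nat \<Rightarrow> 'a::euclidean_space) \<Rightarrow> 'a \<Rightarrow> 'a \<Rightarrow> real" where
  "flight_time w x u = Inf {t. t > 0 \<and> x + t *\<^sub>R u \<in> faces_union w}"

text \<open>
  The first return map.  A point without available face, which necessarily lies on at least
  two faces, is left where it is.
\<close>

definition return_map ::
    "(nat \<Rightarrow> 'a::euclidean_space) \<Rightarrow> (nat \<Rightarrow> 'a) \<Rightarrow> 'a \<Rightarrow> 'a" where
  "return_map w v x =
     (if available_faces w v x = {} then x
      else x + flight_time w x (velocity w v x) *\<^sub>R velocity w v x)"

definition vertex_line_condition ::
    "(nat \<Rightarrow> 'a::euclidean_space) \<Rightarrow> (nat \<Rightarrow> 'a) \<Rightarrow> bool" where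
  "vertex_line_condition w v \<longleftrightarrow>
     (\<forall>i\<le>DIM('a). \<exists>s::real. w i + s *\<^sub>R v i \<in> rel_interior (face w i))"

text \<open>
  For a unit vector \<open>n\<close>, this is the \<open>(d - 1)\<close>-dimensional Lebesgue measure on the hyperplane
  through \<open>q\<close> orthogonal to \<open>n\<close>: the \<open>d\<close>-dimensional Lebesgue measure on a slab of
  thickness 1 over the hyperplane, projected orthogonally to the hyperplane.
\<close>

definition hyperplane_lborel :: "'a::euclidean_space \<Rightarrow> 'a \<Rightarrow> 'a measure" where
  "hyperplane_lborel q n =
     distr (density lborel (indicator {y. 0 \<le> (y - q) \<bullet> n \<and> (y - q) \<bullet> n \<le> 1})) borel
       (\<lambda>y. y - ((y - q) \<bullet> n) *\<^sub>R n)"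

text \<open>
  In an equilateral simplex the altitude from \<open>w i\<close> meets face \<open>i\<close> in its centroid, so the
  vector from the centroid to \<open>w i\<close> is normal to the face.
\<close>

definition face_centroid :: "(nat \<Rightarrow> 'a::euclidean_space) \<Rightarrow> nat \<Rightarrow> 'a" where
  "face_centroid w i = (1 / real DIM('a)) *\<^sub>R (\<Sum>j\<in>{..DIM('a)} - {i}. w j)"

definition face_normal :: "(nat \<Rightarrow> 'a::euclidean_space) \<Rightarrow> nat \<Rightarrow> 'a" where
  "face_normal w i = sgn (w i - face_centroid w i)"

definition surface_measure :: "(nat \<Rightarrow> 'a::euclidean_space) \<Rightarrow> 'a measure" where
  "surface_measure w =
     measure_of (faces_union w) (sets (restrict_space borel (faces_union w)))
       (\<lambda>A. \<Sum>i\<le>DIM('a).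
          emeasure (hyperplane_lborel (face_centroid w i) (face_normal w i)) (A \<inter> face w i))"

definition strongly_chaotic ::
    "(nat \<Rightarrow> 'a::euclidean_space) \<Rightarrow> (nat \<Rightarrow> 'a) \<Rightarrow> bool" where
  "strongly_chaotic w v \<longleftrightarrow>
     (\<exists>M. prob_space M \<and>
          sets M = sets (restrict_space borel (faces_union w)) \<and>
          return_map w v \<in> measurable M M \<and>
          distr M M (return_map w v) = M \<and>
          absolutely_continuous (surface_measure w) M)"

text \<open>
  The set \<open>P\<close> is a periodic orbit of the first return map which is Lyapunov stable and attracts
  every point.  Its points are required to have an available face, so that a point at
  which \<^const>\<open>return_map\<close> is the identity by convention does not count as periodic.
\<close>

definition globally_stable_periodic_orbit ::
    "(nat \<Rightarrow> 'a::euclidean_space) \<Rightarrow> (nat \<Rightarrow> 'a) \<Rightarrow> 'a set \<Rightarrow> bool" where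
  "globally_stable_periodic_orbit w v P \<longleftrightarrow>
     (\<exists>p\<in>faces_union w. \<exists>n\<ge>1.
        (return_map w v ^^ n) p = p \<and> P = (\<lambda>k. (return_map w v ^^ k) p) ` {..<n}) \<and>
     (\<forall>p\<in>P. available_faces w v p \<noteq> {}) \<and>
     (\<forall>\<epsilon>>0. \<exists>\<delta>>0. \<forall>x\<in>faces_union w. infdist x P < \<delta> \<longrightarrow>
        (\<forall>k. infdist ((return_map w v ^^ k) x) P < \<epsilon>)) \<and>
     (\<forall>x\<in>faces_union w. (\<lambda>k. infdist ((return_map w v ^^ k) x) P) \<longlonglongrightarrow> 0)"

end

theory Submission
  imports Defs
begin

text \<open>
  In barycentric coordinates the vertex condition says that the vector of face \<open>i\<close> increases
  coordinate \<open>i\<close> and decreases every other one.  Face \<open>i\<close> then splits, up to a null set, into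
  cells, one for each other face \<open>j\<close>, and the return map sends the \<open>j\<close>-th cell affinely onto the
  whole of face \<open>j\<close>.  Hence measures with a constant density on each face are mapped to such
  measures, and an invariant one is a stationary distribution of a finite Markov chain.

  For the second claim, order the faces cyclically and let the vector of each face be the
  outward normal of the next face.  The return map is then the orthogonal projection to the
  next face.  The squared distance to an explicit orbit visiting all faces decreases by the
  squared normal component at every step, so these components tend to 0, and after a full
  cycle of faces they control all barycentric coordinates.
\<close>

text \<open>\<open>surface_measure\<close> is built from the d-dimensional measure of slabs over
  hyperplanes, while a branch of the return map only links two hyperplanes. Each branch is therefore
  extended to an affine bijection of the whole space that carries slabs to slabs, and uniqueness of
  translation invariant measures supplies a constant factor. Its value is never computed: applying
  the transfer formula to all of \<open>faces_union w\<close> already shows that the factors,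
  weighted by the face areas, form a stochastic matrix.

  Points on several faces need different care in the two halves. Under the vertex condition no
  motion is available from such a point, but these points form a null set. For the cyclic billiard
  every starting point counts; there each point has an available face, and one step leads into the
  relative interior of a face, so the fixed order of the faces can influence the first step only.

  The second half is a cyclic projection (Kaczmarz) iteration for hyperplanes without a common
  point, which settles on a limit cycle instead of a fixed point. Knowing that cycle explicitly
  turns the problem into the decay of a difference of two trajectories.\<close>

section \<open>Barycentric coordinates of an equilateral simplex\<close>

text \<open>The squared altitude of the equilateral unit \<open>d\<close>-simplex.\<close>
definition height_sq :: "nat \<Rightarrow> real" where
  "height_sq d = (real d + 1) / (2 * real d)"

lemma height_sq_pos: "d > 0 \<Longrightarrow> height_sq d > 0"
  by (simp add: height_sq_def)

locale equilateral_simplex =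
  fixes w :: "nat \<Rightarrow> 'a::euclidean_space"
  assumes unit_dist: "\<And>i j. i \<le> DIM('a) \<Longrightarrow> j \<le> DIM('a) \<Longrightarrow> i \<noteq> j \<Longrightarrow> dist (w i) (w j) = 1"
begin

definition altitude :: "nat \<Rightarrow> 'a" where
  "altitude i = w i - face_centroid w i"

text \<open>\<open>bary i\<close> is the \<open>i\<close>-th barycentric coordinate and \<open>blin i\<close> its linear part.\<close>
definition blin :: "nat \<Rightarrow> 'a \<Rightarrow> real" where
  "blin i u = (u \<bullet> altitude i) / height_sq DIM('a)"

definition bary :: "nat \<Rightarrow> 'a \<Rightarrow> real" where
  "bary i y = blin i (y - face_centroid w i)"

lemma height_pos: "height_sq DIM('a) > 0"
  by (rule height_sq_pos) simp

text \<open>Polarization of the unit edge lengths. In the difference \<open>w j - w l\<close> the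
  term \<open>w k \<bullet> w k\<close> cancels, so the result can be averaged over
  \<open>k\<close>.\<close>

lemma inner_diff_vertex:
  assumes "j \<le> DIM('a)" "l \<le> DIM('a)" "k \<le> DIM('a)"
  shows "(w j - w l) \<bullet> w k = (w j \<bullet> w j - w l \<bullet> w l) / 2 + (if k = j then 1/2 else 0) - (if k = l then 1/2 else 0)"
proof -
  have *: "w a \<bullet> w b = (w a \<bullet> w a + w b \<bullet> w b) / 2 - (if a = b then 0 else 1/2)"
    if "a \<le> DIM('a)" "b \<le> DIM('a)" for a b
  proof (cases "a = b")
    case False
    then have "norm (w a - w b) ^ 2 = 1"
      using unit_dist[OF that] by (simp add: dist_norm)
    then have "w a \<bullet> w a - 2 * (w a \<bullet> w b) + w b \<bullet> w b = 1"
      by (simp add: power2_norm_eq_inner inner_diff inner_commute)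
    then show ?thesis using False by (simp add: field_simps)
  qed simp
  show ?thesis
    unfolding inner_diff_left using *[of j k] *[of l k] assms by (auto simp: field_simps)
qed

lemma inner_diff_centroid:
  assumes "j \<le> DIM('a)" "l \<le> DIM('a)" "i \<le> DIM('a)"
  shows "(w j - w l) \<bullet> face_centroid w i = (w j \<bullet> w j - w l \<bullet> w l) / 2
     + (if j \<noteq> i then 1 / (2 * real DIM('a)) else 0) - (if l \<noteq> i then 1 / (2 * real DIM('a)) else 0)"
proof -
  let ?S = "{..DIM('a)} - {i}"
  have card: "card ?S = DIM('a)" using assms by simp
  have "(\<Sum>k\<in>?S. (w j - w l) \<bullet> w k)
      = (\<Sum>k\<in>?S. (w j \<bullet> w j - w l \<bullet> w l) / 2 + (if k = j then 1/2 else 0) - (if k = l then 1/2 else 0))"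
    by (rule sum.cong) (use assms in \<open>auto simp: inner_diff_vertex\<close>)
  also have "\<dots> = DIM('a) * ((w j \<bullet> w j - w l \<bullet> w l) / 2) + (if j \<noteq> i then 1/2 else 0) - (if l \<noteq> i then 1/2 else 0)"
    using assms card by (auto simp: sum.distrib sum_subtractf sum.delta)
  finally show ?thesis
    by (simp add: face_centroid_def inner_sum_right add_divide_distrib diff_divide_distrib)
qed

text \<open>The norm terms of vertex and centroid cancel and leave \<open>1/2 + 1/(2 * d)\<close>,
  which is \<open>height_sq d\<close>. With \<open>j\<close> and \<open>l\<close> both different
  from \<open>i\<close> this is orthogonality of \<open>altitude i\<close> to face
  \<open>i\<close>.\<close>

lemma inner_diff_altitude:
  assumes "j \<le> DIM('a)" "l \<le> DIM('a)" "i \<le> DIM('a)"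
  shows "(w j - w l) \<bullet> altitude i = (if j = i then height_sq DIM('a) else 0) - (if l = i then height_sq DIM('a) else 0)"
  using assms unfolding altitude_def inner_diff_right height_sq_def
  by (auto simp: inner_diff_vertex inner_diff_centroid field_simps)

lemma vertex_minus_centroid:
  assumes "i \<le> DIM('a)"
  shows "y - face_centroid w i = (1 / real DIM('a)) *\<^sub>R (\<Sum>k\<in>{..DIM('a)} - {i}. y - w k)"
proof -
  have "card ({..DIM('a)} - {i}) = DIM('a)" using assms by simp
  then show ?thesis
    by (simp add: face_centroid_def sum_subtractf scaleR_diff_right sum_constant_scaleR del: sum_constant)
qed

text \<open>Subtracting the centroid averages the differences to the vertices of face
  \<open>i\<close>. The resulting duality between \<open>bary\<close> and the vertices carries all
  later work with coordinates.\<close>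

lemma bary_vertex:
  assumes "i \<le> DIM('a)" "j \<le> DIM('a)"
  shows "bary i (w j) = (if i = j then 1 else 0)"
proof -
  have c: "card ({..DIM('a)} - {i}) = DIM('a)" using assms by simp
  have "(w j - face_centroid w i) \<bullet> altitude i
      = (1 / real DIM('a)) * (\<Sum>k\<in>{..DIM('a)} - {i}. (w j - w k) \<bullet> altitude i)"
    using assms by (simp add: vertex_minus_centroid inner_sum_left)
  also have "(\<Sum>k\<in>{..DIM('a)} - {i}. (w j - w k) \<bullet> altitude i) = (\<Sum>k\<in>{..DIM('a)} - {i}. if i = j then height_sq DIM('a) else 0)"
    by (rule sum.cong) (use assms in \<open>auto simp: inner_diff_altitude\<close>)
  finally show ?thesis
    using height_pos c unfolding bary_def blin_def by auto
qed

lemma blin_add: "blin i (u + u') = blin i u + blin i u'"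
  and blin_diff: "blin i (u - u') = blin i u - blin i u'"
  and blin_scaleR: "blin i (c *\<^sub>R u) = c * blin i u"
  and blin_minus: "blin i (- u) = - blin i u"
  and blin_zero [simp]: "blin i 0 = 0"
  by (simp_all add: blin_def inner_add inner_diff add_divide_distrib diff_divide_distrib)

lemma blin_sum: "blin i (sum f A) = (\<Sum>k\<in>A. blin i (f k))"
  by (simp add: blin_def inner_sum_left sum_divide_distrib)

lemma bary_add: "bary i (y + u) = bary i y + blin i u"
  and bary_diff: "bary i (y - u) = bary i y - blin i u"
  and blin_eq_bary_diff: "blin i (y - z) = bary i y - bary i z"
  by (simp_all add: bary_def blin_add blin_diff)

lemma bary_affine_sum:
  assumes "finite A" "sum c A = 1"
  shows "bary i (\<Sum>k\<in>A. c k *\<^sub>R f k) = (\<Sum>k\<in>A. c k * bary i (f k))"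
proof -
  have "(\<Sum>k\<in>A. c k *\<^sub>R f k) - face_centroid w i = (\<Sum>k\<in>A. c k *\<^sub>R (f k - face_centroid w i))"
    using assms by (simp add: scaleR_diff_right sum_subtractf flip: scaleR_left.sum)
  then show ?thesis
    by (simp add: bary_def blin_sum blin_scaleR)
qed

lemma inj_vertex: "inj_on w {..DIM('a)}"
  by (rule inj_onI) (metis atMost_iff bary_vertex zero_neq_one)

text \<open>By duality, \<open>bary i\<close> applied to a dependency isolates its
  \<open>i\<close>-th coefficient. Independence thus follows from the distances alone, which is what
  the constructed simplex of the second half needs.\<close>

lemma affine_independent_vertices: "\<not> affine_dependent (w ` {..DIM('a)})"
proof
  assume "affine_dependent (w ` {..DIM('a)})"
  then obtain U v where U: "sum U (w ` {..DIM('a)}) = 0" "v \<in> w ` {..DIM('a)}" "U v \<noteq> 0"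
    "(\<Sum>v\<in>w ` {..DIM('a)}. U v *\<^sub>R v) = 0"
    by (auto simp: affine_dependent_explicit_finite)
  then obtain i where i: "i \<le> DIM('a)" "v = w i" by auto
  have s0: "(\<Sum>k\<le>DIM('a). U (w k)) = 0" and s1: "(\<Sum>k\<le>DIM('a). U (w k) *\<^sub>R w k) = 0"
    using U(1,4) by (simp_all add: sum.reindex[OF inj_vertex] o_def)
  \<comment> \<open>The coefficients sum to 0, so the base point may be shifted to the
    centroid.\<close>
  have "(\<Sum>k\<le>DIM('a). U (w k) *\<^sub>R (w k - face_centroid w i)) = 0"
    using s0 s1 by (simp add: scaleR_diff_right sum_subtractf flip: scaleR_left.sum)
  then have "blin i (\<Sum>k\<le>DIM('a). U (w k) *\<^sub>R (w k - face_centroid w i)) = 0" by simp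
  then have "(\<Sum>k\<le>DIM('a). U (w k) * bary i (w k)) = 0"
    by (simp add: blin_sum blin_scaleR bary_def)
  also have "(\<Sum>k\<le>DIM('a). U (w k) * bary i (w k)) = (\<Sum>k\<le>DIM('a). if k = i then U (w i) else 0)"
    by (rule sum.cong) (use i in \<open>auto simp: bary_vertex\<close>)
  finally show False using U i by simp
qed

text \<open>\<open>d + 1\<close> affinely independent points span the space, so every point is an
  affine combination of the vertices, and duality identifies its coefficients with
  \<open>bary\<close>.\<close>

lemma sum_bary: "(\<Sum>j\<le>DIM('a). bary j y) = 1"
  and bary_repr: "(\<Sum>j\<le>DIM('a). bary j y *\<^sub>R w j) = y"
proof -
  have "affine hull (w ` {..DIM('a)}) = UNIV"
    using affine_independent_vertices by (intro affine_independent_span_eq) (auto simp: card_image[OF inj_vertex])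
  then obtain u where u: "sum u (w ` {..DIM('a)}) = 1" "(\<Sum>v\<in>w ` {..DIM('a)}. u v *\<^sub>R v) = y"
    using affine_hull_finite[of "w ` {..DIM('a)}"] by auto
  define c where "c j = u (w j)" for j
  have c: "(\<Sum>j\<le>DIM('a). c j) = 1" "(\<Sum>j\<le>DIM('a). c j *\<^sub>R w j) = y"
    using u by (simp_all add: sum.reindex[OF inj_vertex] o_def c_def)
  have cb: "c j = bary j y" if "j \<le> DIM('a)" for j
  proof -
    have "bary j y = (\<Sum>k\<le>DIM('a). c k * bary j (w k))"
      using bary_affine_sum[of "{..DIM('a)}" c j w] c by simp
    also have "\<dots> = (\<Sum>k\<le>DIM('a). if k = j then c j else 0)"
      by (rule sum.cong) (use that in \<open>auto simp: bary_vertex\<close>)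
    finally show ?thesis using that by simp
  qed
  show "(\<Sum>j\<le>DIM('a). bary j y) = 1" "(\<Sum>j\<le>DIM('a). bary j y *\<^sub>R w j) = y"
    using c cb by simp_all
qed

lemma bary_eqI: "(\<And>j. j \<le> DIM('a) \<Longrightarrow> bary j x = bary j y) \<Longrightarrow> x = y"
  using bary_repr[of x] bary_repr[of y] by (metis (mono_tags, lifting) atMost_iff sum.cong)

lemma bary_combination:
  assumes "(\<Sum>k\<le>DIM('a). c k) = 1" "j \<le> DIM('a)"
  shows "bary j (\<Sum>k\<le>DIM('a). c k *\<^sub>R w k) = c j"
proof -
  have "bary j (\<Sum>k\<le>DIM('a). c k *\<^sub>R w k) = (\<Sum>k\<le>DIM('a). c k * bary j (w k))"
    using bary_affine_sum[of "{..DIM('a)}" c j w] assms by simp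
  also have "\<dots> = (\<Sum>k\<le>DIM('a). if k = j then c j else 0)"
    by (rule sum.cong) (use assms in \<open>auto simp: bary_vertex\<close>)
  finally show ?thesis using assms by simp
qed

lemma continuous_on_bary [continuous_intros]:
  "continuous_on S f \<Longrightarrow> continuous_on S (\<lambda>x. bary i (f x))"
  unfolding bary_def blin_def using height_pos by (intro continuous_intros) auto

lemma borel_measurable_bary [measurable]: "bary i \<in> borel_measurable borel"
  by (intro borel_measurable_continuous_onI continuous_intros)

text \<open>An arbitrary index set covers the faces and the whole pyramid at once. The conditions on
  \<open>bary\<close> cut out a convex set; conversely, \<open>bary_repr\<close> already is the
  required convex combination.\<close>

lemma in_subface_iff:
  assumes "I \<subseteq> {..DIM('a)}"
  shows "x \<in> convex hull (w ` I) \<longleftrightarrow>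
    (\<forall>j\<le>DIM('a). 0 \<le> bary j x \<and> (j \<notin> I \<longrightarrow> bary j x = 0))" (is "_ \<longleftrightarrow> ?R x")
proof
  have "convex hull (w ` I) \<subseteq> {x. ?R x}"
  proof (rule hull_minimal)
    show "w ` I \<subseteq> {x. ?R x}"
      using assms by (auto simp: bary_vertex)
    show "convex {x. ?R x}"
    proof (rule convexI)
      fix x y and s t :: real
      assume "x \<in> {x. ?R x}" "y \<in> {x. ?R x}" and st: "0 \<le> s" "0 \<le> t" "s + t = 1"
      moreover have "bary j (s *\<^sub>R x + t *\<^sub>R y) = s * bary j x + t * bary j y" for j
      proof -
        have "s *\<^sub>R x + t *\<^sub>R y - face_centroid w j = s *\<^sub>R (x - face_centroid w j) + t *\<^sub>R (y - face_centroid w j)"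
          using st(3) by (simp add: algebra_simps flip: scaleR_left_distrib)
        then show ?thesis by (simp add: bary_def blin_add blin_scaleR)
      qed
      ultimately show "s *\<^sub>R x + t *\<^sub>R y \<in> {x. ?R x}" by auto
    qed
  qed
  then show "x \<in> convex hull (w ` I) \<Longrightarrow> ?R x" by blast
next
  assume R: "?R x"
  have fin: "finite I" using assms finite_subset by blast
  have "x = (\<Sum>j\<in>I. bary j x *\<^sub>R w j)"
    using assms R by (subst bary_repr[symmetric], intro sum.mono_neutral_right) auto
  moreover have "(\<Sum>j\<in>I. bary j x) = 1"
    using assms R by (subst sum_bary[of x, symmetric], intro sum.mono_neutral_left) auto
  moreover have "(\<Sum>j\<in>I. bary j x *\<^sub>R w j) \<in> convex hull (w ` I)"
    if "(\<Sum>j\<in>I. bary j x) = 1"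
    using that R assms fin by (intro convex_sum) (auto intro: hull_inc)
  ultimately show "x \<in> convex hull (w ` I)" by simp
qed

lemma in_rel_interior_subface_iff:
  assumes "I \<subseteq> {..DIM('a)}"
  shows "x \<in> rel_interior (convex hull (w ` I)) \<longleftrightarrow>
    (\<forall>j\<le>DIM('a). if j \<in> I then bary j x > 0 else bary j x = 0)" (is "_ \<longleftrightarrow> ?R")
proof -
  have fin: "finite I" using assms finite_subset by blast
  have inj: "inj_on w I" using inj_vertex assms inj_on_subset by blast
  have ind: "\<not> affine_dependent (w ` I)"
    using affine_independent_vertices assms affine_dependent_subset by blast
  have expl: "x \<in> rel_interior (convex hull (w ` I)) \<longleftrightarrow>
      (\<exists>u. (\<forall>k\<in>I. 0 < u (w k)) \<and> (\<Sum>k\<in>I. u (w k)) = 1 \<and> (\<Sum>k\<in>I. u (w k) *\<^sub>R w k) = x)"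
    by (simp add: rel_interior_convex_hull_explicit[OF ind] sum.reindex[OF inj] o_def)
  show ?thesis
  proof
    assume "x \<in> rel_interior (convex hull (w ` I))"
    then obtain u where u: "\<forall>k\<in>I. 0 < u (w k)" "(\<Sum>k\<in>I. u (w k)) = 1" "(\<Sum>k\<in>I. u (w k) *\<^sub>R w k) = x"
      using expl by blast
    define c where "c k = (if k \<in> I then u (w k) else 0)" for k
    have "(\<Sum>k\<le>DIM('a). c k) = 1"
      using u(2) assms fin by (subst sum.mono_neutral_right[of _ I]) (auto simp: c_def)
    moreover have "(\<Sum>k\<le>DIM('a). c k *\<^sub>R w k) = x"
      using u(3) assms fin by (subst sum.mono_neutral_right[of _ I]) (auto simp: c_def)
    ultimately have "\<And>j. j \<le> DIM('a) \<Longrightarrow> bary j x = c j"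
      using bary_combination by blast
    then show ?R using u(1) by (auto simp: c_def)
  next
    assume R: ?R
    define u where "u v = bary (inv_into {..DIM('a)} w v) x" for v
    have uw: "u (w k) = bary k x" if "k \<in> I" for k
      using that assms inj_vertex by (auto simp: u_def)
    have "(\<Sum>j\<in>I. bary j x *\<^sub>R w j) = x"
      using assms R by (subst (2) bary_repr[symmetric], intro sum.mono_neutral_left) auto
    moreover have "(\<Sum>j\<in>I. bary j x) = 1"
      using assms R by (subst sum_bary[of x, symmetric], intro sum.mono_neutral_left) auto
    ultimately show "x \<in> rel_interior (convex hull (w ` I))"
      unfolding expl using R assms by (intro exI[of _ u]) (auto simp: uw)
  qed
qed

section \<open>Pyramid, faces and directions in coordinates\<close>

lemma in_pyramid_iff: "x \<in> pyramid w \<longleftrightarrow> (\<forall>j\<le>DIM('a). 0 \<le> bary j x)"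
  unfolding pyramid_def by (subst in_subface_iff) auto

lemma in_face_iff:
  assumes "i \<le> DIM('a)"
  shows "x \<in> face w i \<longleftrightarrow> bary i x = 0 \<and> (\<forall>j\<le>DIM('a). 0 \<le> bary j x)"
proof -
  have "x \<in> face w i \<longleftrightarrow> (\<forall>j\<le>DIM('a). 0 \<le> bary j x \<and> (j = i \<longrightarrow> bary j x = 0))"
    unfolding face_def by (subst in_subface_iff) simp_all
  with assms show ?thesis by blast
qed

lemma in_rel_interior_face_iff:
  assumes "i \<le> DIM('a)"
  shows "x \<in> rel_interior (face w i) \<longleftrightarrow>
    bary i x = 0 \<and> (\<forall>j\<le>DIM('a). j \<noteq> i \<longrightarrow> 0 < bary j x)"
proof -
  have "x \<in> rel_interior (face w i) \<longleftrightarrow>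
      (\<forall>j\<le>DIM('a). if j \<noteq> i then bary j x > 0 else bary j x = 0)"
    unfolding face_def by (subst in_rel_interior_subface_iff) simp_all
  with assms show ?thesis by metis
qed

lemma in_interior_pyramid_iff: "x \<in> interior (pyramid w) \<longleftrightarrow> (\<forall>j\<le>DIM('a). 0 < bary j x)"
proof -
  have "affine hull (w ` {..DIM('a)}) = UNIV"
    using affine_independent_vertices by (intro affine_independent_span_eq) (auto simp: card_image[OF inj_vertex])
  then have "rel_interior (pyramid w) = interior (pyramid w)"
    unfolding pyramid_def by (intro rel_interior_interior) (simp add: affine_hull_convex_hull)
  then show ?thesis
    unfolding pyramid_def using in_rel_interior_subface_iff[of "{..DIM('a)}" x] by simp
qed

lemma in_faces_union_iff:
  "x \<in> faces_union w \<longleftrightarrow> (\<forall>j\<le>DIM('a). 0 \<le> bary j x) \<and> (\<exists>i\<le>DIM('a). bary i x = 0)"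
proof -
  have "x \<in> faces_union w \<longleftrightarrow> (\<exists>i\<le>DIM('a). x \<in> face w i)"
    unfolding faces_union_def by blast
  also have "\<dots> \<longleftrightarrow> (\<exists>i\<le>DIM('a). bary i x = 0 \<and> (\<forall>j\<le>DIM('a). 0 \<le> bary j x))"
    by (intro ex_cong1 conj_cong refl in_face_iff)
  finally show ?thesis by blast
qed

text \<open>Coordinates that are positive at \<open>x\<close> stay positive for small times, so only
  the vanishing ones constrain the direction.\<close>

lemma directed_into_iff:
  assumes "\<forall>j\<le>DIM('a). 0 \<le> bary j x"
  shows "directed_into w x u \<longleftrightarrow> (\<forall>j\<le>DIM('a). bary j x = 0 \<longrightarrow> 0 < blin j u)"
proof -
  have ev: "eventually (\<lambda>t. 0 < bary j (x + t *\<^sub>R u)) (at_right 0) \<longleftrightarrow> (bary j x = 0 \<longrightarrow> 0 < blin j u)"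
    if "j \<le> DIM('a)" for j
  proof (cases "bary j x = 0")
    case True
    have "eventually (\<lambda>t::real. 0 < t * blin j u \<longleftrightarrow> 0 < blin j u) (at_right 0)"
      unfolding eventually_at_right_field by (rule exI[of _ 1]) (auto simp: zero_less_mult_iff)
    then have "eventually (\<lambda>t::real. 0 < t * blin j u) (at_right 0) \<longleftrightarrow> eventually (\<lambda>t::real. 0 < blin j u) (at_right 0)"
      by (rule eventually_subst)
    then show ?thesis using True by (simp add: bary_add blin_scaleR)
  next
    case False
    have "((\<lambda>t. bary j x + t * blin j u) \<longlongrightarrow> bary j x + 0 * blin j u) (at_right 0)"
      by (intro tendsto_intros)
    moreover have "0 < bary j x" using False assms that by (simp add: order_less_le)
    ultimately have "eventually (\<lambda>t. 0 < bary j x + t * blin j u) (at_right 0)"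
      by (intro order_tendstoD(1)[of _ "bary j x"]) auto
    then show ?thesis using False by (simp add: bary_add blin_scaleR)
  qed
  have "directed_into w x u \<longleftrightarrow> eventually (\<lambda>t. \<forall>j\<in>{..DIM('a)}. 0 < bary j (x + t *\<^sub>R u)) (at_right 0)"
    by (simp add: directed_into_def in_interior_pyramid_iff Ball_def)
  also have "\<dots> \<longleftrightarrow> (\<forall>j\<in>{..DIM('a)}. eventually (\<lambda>t. 0 < bary j (x + t *\<^sub>R u)) (at_right 0))"
    by (rule eventually_ball_finite_distrib) simp
  finally show ?thesis using ev by auto
qed

lemma available_faces_iff:
  assumes "x \<in> faces_union w"
  shows "i \<in> available_faces w v x \<longleftrightarrow>
    i \<le> DIM('a) \<and> bary i x = 0 \<and> (\<forall>j\<le>DIM('a). bary j x = 0 \<longrightarrow> 0 < blin j (v i))"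
proof -
  have nonneg: "\<forall>j\<le>DIM('a). 0 \<le> bary j x" using assms by (simp add: in_faces_union_iff)
  show ?thesis
    unfolding available_faces_def mem_Collect_eq directed_into_iff[OF nonneg]
    using in_face_iff[of i x] nonneg by blast
qed

text \<open>In both billiards a trajectory meets the boundary exactly once after leaving it, so the
  infimum is taken over a singleton.\<close>

lemma flight_timeI:
  assumes "t > 0" "x + t *\<^sub>R u \<in> faces_union w"
    and "\<And>s. s > 0 \<Longrightarrow> x + s *\<^sub>R u \<in> faces_union w \<Longrightarrow> s = t"
  shows "flight_time w x u = t"
proof -
  have "{t. t > 0 \<and> x + t *\<^sub>R u \<in> faces_union w} = {t}" using assms by blast
  then show ?thesis by (simp add: flight_time_def)
qed

lemma bary_face_centroid:
  assumes "i \<le> DIM('a)" "j \<le> DIM('a)"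
  shows "bary j (face_centroid w i) = (if j = i then 0 else 1 / real DIM('a))"
proof -
  define c where "c j = (if j = i then 0 else 1 / real DIM('a))" for j
  have "(\<Sum>j\<le>DIM('a). c j) = (\<Sum>j\<in>{..DIM('a)} - {i}. 1 / real DIM('a))"
    by (rule sum.mono_neutral_cong_right) (auto simp: c_def)
  then have "(\<Sum>j\<le>DIM('a). c j) = 1" using assms by simp
  moreover have "face_centroid w i = (\<Sum>j\<le>DIM('a). c j *\<^sub>R w j)"
    unfolding face_centroid_def scaleR_sum_right
    by (rule sum.mono_neutral_cong_left) (use assms in \<open>auto simp: c_def\<close>)
  ultimately show ?thesis
    using bary_combination assms by (metis c_def)
qed

lemma face_centroid_in_rel_interior:
  assumes "i \<le> DIM('a)" shows "face_centroid w i \<in> rel_interior (face w i)"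
  using assms by (simp add: in_rel_interior_face_iff bary_face_centroid)

lemma blin_altitude:
  assumes "i \<le> DIM('a)" "j \<le> DIM('a)"
  shows "blin j (altitude i) = (if j = i then 1 else - (1 / real DIM('a)))"
  using assms unfolding altitude_def blin_eq_bary_diff by (auto simp: bary_vertex bary_face_centroid)

lemma inner_altitude_self:
  assumes "i \<le> DIM('a)" shows "altitude i \<bullet> altitude i = height_sq DIM('a)"
  using blin_altitude[OF assms assms] height_pos by (simp add: blin_def)

lemma norm_altitude:
  assumes "i \<le> DIM('a)" shows "norm (altitude i) = sqrt (height_sq DIM('a))"
  using inner_altitude_self[OF assms] by (simp add: norm_eq_sqrt_inner)

lemma face_normal_eq:
  assumes "i \<le> DIM('a)" shows "face_normal w i = (1 / sqrt (height_sq DIM('a))) *\<^sub>R altitude i"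
  using norm_altitude[OF assms] by (simp add: face_normal_def altitude_def sgn_div_norm divide_inverse)

end

section \<open>Affine bijections and Lebesgue measure\<close>

text \<open>Uniqueness of Haar measure by the classical Fubini argument with a unit box. Finiteness
  on bounded sets gives both the sigma-finiteness that Fubini requires and a finite factor.\<close>

lemma translation_invariant_measure_eq_lborel:
  fixes M :: "'a::euclidean_space measure"
  assumes sets [measurable_cong]: "sets M = sets borel"
    and transl: "\<And>a. distr M borel ((+) a) = M"
    and bdd: "\<And>A. bounded A \<Longrightarrow> A \<in> sets borel \<Longrightarrow> emeasure M A < \<infinity>"
  obtains c where "0 \<le> c" "\<And>A. A \<in> sets borel \<Longrightarrow> emeasure M A = ennreal c * emeasure lborel A"
proof -
  interpret M: sigma_finite_measure M
  proof
    show "\<exists>A. countable A \<and> A \<subseteq> sets M \<and> \<Union> A = space M \<and> (\<forall>a\<in>A. emeasure M a \<noteq> \<infinity>)"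
    proof (intro exI conjI ballI)
      show "countable (range (\<lambda>n::nat. cball (0::'a) (real n)))" by simp
      show "range (\<lambda>n::nat. cball (0::'a) (real n)) \<subseteq> sets M" by (auto simp: sets)
      show "\<Union> (range (\<lambda>n::nat. cball (0::'a) (real n))) = space M"
        using sets_eq_imp_space_eq[OF sets] real_arch_simple by (auto simp: dist_norm)
      show "emeasure M a \<noteq> \<infinity>" if "a \<in> range (\<lambda>n::nat. cball (0::'a) (real n))" for a
        using that bdd[of a] by (auto simp: top.not_eq_extremum)
    qed
  qed
  interpret P: pair_sigma_finite M lborel ..
  define B where "B = box (0::'a) One"
  \<comment> \<open>Substituting \<open>y + x\<close> for \<open>x\<close> turns
    \<open>y - x\<close> into \<open>- x\<close>, hence the reflected box.\<close>
  define B' where "B' = (\<lambda>x. - x) -` B"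
  have B [measurable]: "B \<in> sets borel" "B' \<in> sets borel"
    unfolding B_def B'_def by (auto intro!: measurable_sets_borel[of uminus borel])
  have B1: "emeasure lborel B = 1"
    by (simp add: B_def emeasure_lborel_box_eq)
  have bB': "bounded B'"
  proof -
    have "B' = uminus ` B" by (auto simp: B'_def intro: image_eqI[of _ _ "- x" for x])
    then show ?thesis by (simp add: B_def)
  qed
  have "emeasure M A = emeasure M B' * emeasure lborel A" if A [measurable]: "A \<in> sets borel" for A
  proof -
    have "emeasure M A = (\<integral>\<^sup>+x. indicator A x \<partial>M)"
      using A sets by simp
    also have "\<dots> = (\<integral>\<^sup>+x. \<integral>\<^sup>+y. indicator A x * indicator B y \<partial>lborel \<partial>M)"
      by (simp add: nn_integral_cmult B1)
    \<comment> \<open>Shear by the invariance of \<^const>\<open>lborel\<close>, swap the integrals, then shear by the invariance of \<open>M\<close>.\<close>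
    also have "\<dots> = (\<integral>\<^sup>+x. \<integral>\<^sup>+y. indicator A x * indicator B (y - x) \<partial>lborel \<partial>M)"
    proof (rule nn_integral_cong)
      fix x
      have "(\<integral>\<^sup>+y. indicator A x * indicator B y \<partial>lborel)
          = (\<integral>\<^sup>+y. indicator A x * indicator B y \<partial>distr lborel borel ((+) (- x)))"
        by (simp add: lborel_distr_plus)
      also have "\<dots> = (\<integral>\<^sup>+y. indicator A x * indicator B (y - x) \<partial>lborel)"
        by (subst nn_integral_distr) (auto simp: algebra_simps)
      finally show "(\<integral>\<^sup>+y. indicator A x * indicator B y \<partial>lborel) = (\<integral>\<^sup>+y. indicator A x * indicator B (y - x) \<partial>lborel)" .
    qed
    also have "\<dots> = (\<integral>\<^sup>+y. \<integral>\<^sup>+x. indicator A x * indicator B (y - x) \<partial>M \<partial>lborel)"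
      by (intro P.Fubini'[symmetric]) measurable
    also have "\<dots> = (\<integral>\<^sup>+y. \<integral>\<^sup>+x. indicator A (y + x) * indicator B' x \<partial>M \<partial>lborel)"
    proof (rule nn_integral_cong)
      fix y
      have "(\<integral>\<^sup>+x. indicator A x * indicator B (y - x) \<partial>M)
          = (\<integral>\<^sup>+x. indicator A x * indicator B (y - x) \<partial>distr M borel ((+) y))"
        by (simp add: transl)
      also have "\<dots> = (\<integral>\<^sup>+x. indicator A (y + x) * indicator B' x \<partial>M)"
        by (subst nn_integral_distr) (auto simp: sets B'_def indicator_def)
      finally show "(\<integral>\<^sup>+x. indicator A x * indicator B (y - x) \<partial>M) = (\<integral>\<^sup>+x. indicator A (y + x) * indicator B' x \<partial>M)" .
    qed
    also have "\<dots> = (\<integral>\<^sup>+x. \<integral>\<^sup>+y. indicator A (y + x) * indicator B' x \<partial>lborel \<partial>M)"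
      by (intro P.Fubini') measurable
    also have "\<dots> = (\<integral>\<^sup>+x. emeasure lborel A * indicator B' x \<partial>M)"
    proof (rule nn_integral_cong)
      fix x
      have "(\<integral>\<^sup>+y. indicator A (y + x) * indicator B' x \<partial>lborel)
          = (\<integral>\<^sup>+y. indicator A y * indicator B' x \<partial>distr lborel borel ((+) x))"
        by (subst nn_integral_distr) (auto simp: add.commute)
      then show "(\<integral>\<^sup>+y. indicator A (y + x) * indicator B' x \<partial>lborel) = emeasure lborel A * indicator B' x"
        by (simp add: lborel_distr_plus nn_integral_multc)
    qed
    also have "\<dots> = emeasure lborel A * emeasure M B'"
      by (simp add: nn_integral_cmult sets)
    finally show ?thesis by (simp add: mult.commute)
  qed
  moreover have "emeasure M B' < \<infinity>" using bdd bB' B by blast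
  then obtain c where "emeasure M B' = ennreal c" "0 \<le> c"
    by (cases "emeasure M B'") auto
  ultimately show ?thesis using that by metis
qed

text \<open>The image of \<open>lborel\<close> under \<open>G\<close> is again translation
  invariant: a shift by \<open>a = L b\<close> after \<open>G\<close> is a shift by \<open>b\<close>
  before it, and \<open>L\<close> is onto. Boundedness of preimages comes from a linear left inverse
  of \<open>L\<close>.\<close>

lemma affine_bijection_scales_lborel:
  fixes G :: "'a::euclidean_space \<Rightarrow> 'a"
  assumes lin: "linear L" and G: "\<And>y. G y = L y + z" and inj: "inj G"
  obtains c where "0 \<le> c"
    "\<And>A. A \<in> sets borel \<Longrightarrow> emeasure lborel (G -` A) = ennreal c * emeasure lborel A"
proof -
  interpret L: linear L by fact
  have injL: "inj L"
    by (rule injI) (metis G inj injD)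
  then have surj: "surj L" using lin linear_injective_imp_surjective by blast
  have contL: "continuous_on UNIV L" using lin by (rule linear_continuous_on[OF linear_conv_bounded_linear[THEN iffD1]])
  have contG: "continuous_on UNIV G" unfolding G by (intro continuous_intros contL)
  then have G_meas [measurable]: "G \<in> borel_measurable borel"
    by (rule borel_measurable_continuous_onI)
  let ?M = "distr lborel borel G"
  obtain c where c: "0 \<le> c" "\<And>A. A \<in> sets borel \<Longrightarrow> emeasure ?M A = ennreal c * emeasure lborel A"
  proof (rule translation_invariant_measure_eq_lborel[of ?M])
    fix a
    obtain b where b: "L b = a" using surj by (metis surjD)
    have eq: "(+) a \<circ> G = G \<circ> (+) b" by (auto simp: G L.add b)
    have "distr ?M borel ((+) a) = distr lborel borel ((+) a \<circ> G)"
      by (rule distr_distr) auto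
    also have "\<dots> = distr (distr lborel borel ((+) b)) borel G"
      unfolding eq by (subst distr_distr) auto
    finally show "distr ?M borel ((+) a) = ?M" by (simp add: lborel_distr_plus)
  next
    fix A :: "'a set" assume A: "bounded A" "A \<in> sets borel"
    obtain L' where L': "linear L'" "L' \<circ> L = id"
      using linear_injective_left_inverse[OF lin injL] by blast
    have "G -` A \<subseteq> L' ` ((\<lambda>y. y - z) ` A)"
    proof
      fix y assume "y \<in> G -` A"
      moreover have "y = L' (G y - z)" using L'(2) by (simp add: G o_def fun_eq_iff)
      ultimately show "y \<in> L' ` ((\<lambda>y. y - z) ` A)" by blast
    qed
    moreover have "bounded (L' ` ((\<lambda>y. y - z) ` A))"
      using A(1) L'(1) by (intro bounded_linear_image bounded_translation_minus) (simp_all add: linear_conv_bounded_linear)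
    ultimately have "bounded (G -` A)" by (rule bounded_subset[rotated])
    then have "emeasure lborel (G -` A) < \<infinity>" by (rule emeasure_bounded_finite)
    then show "emeasure ?M A < \<infinity>" using A by (simp add: emeasure_distr)
  qed (simp, blast)
  show ?thesis
    by (rule that[OF c(1)]) (use c(2) in \<open>simp add: emeasure_distr\<close>)
qed

section \<open>Measures on the faces\<close>

text \<open>One point off the zero set rules out the trivial equation; what remains is a hyperplane
  or the empty set.\<close>

lemma null_sets_affine_zero:
  fixes a :: "'a::euclidean_space"
  assumes "a \<bullet> y + b \<noteq> 0"
  shows "{x. a \<bullet> x + b = 0} \<in> null_sets lborel"
proof -
  have "a \<noteq> 0 \<or> - b \<noteq> 0" using assms by auto
  then have "negligible {x. a \<bullet> x = - b}" by (rule negligible_hyperplane)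
  moreover have "{x. a \<bullet> x = - b} = {x. a \<bullet> x + b = 0}" by (auto simp: eq_neg_iff_add_eq_0)
  moreover have "{x. a \<bullet> x + b = 0} \<in> sets lborel" by measurable
  ultimately show ?thesis by (simp add: negligible_iff_null_sets null_sets_completion_iff)
qed

lemma emeasure_lborel_pos:
  fixes S :: "'a::euclidean_space set"
  assumes "open U" "U \<noteq> {}" "U \<subseteq> S" "S \<in> sets borel"
  shows "emeasure lborel S > 0"
proof (rule ccontr)
  assume "\<not> emeasure lborel S > 0"
  then have "S \<in> null_sets lborel" using assms by (auto intro: null_setsI)
  then have "negligible S" using assms by (simp add: negligible_iff_null_sets null_sets_completion_iff)
  then show False using assms open_not_negligible negligible_subset by blast
qed

context equilateral_simplex
begin

text \<open>For a face index \<open>i\<close>, \<open>altitude i\<close> is normal to face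
  \<open>i\<close> and raises \<open>bary i\<close> by 1, so this is the orthogonal projection to
  the hyperplane of the face.\<close>

definition proj :: "nat \<Rightarrow> 'a \<Rightarrow> 'a" where
  "proj i y = y - bary i y *\<^sub>R altitude i"

definition plane_measure :: "nat \<Rightarrow> 'a measure" where
  "plane_measure i = hyperplane_lborel (face_centroid w i) (face_normal w i)"

text \<open>Thickness 1 in distance is \<open>1 / sqrt (height_sq d)\<close> in terms of
  \<open>bary i\<close>, since \<open>bary i\<close> grows by 1 along an altitude of length
  \<open>sqrt (height_sq d)\<close>.\<close>

definition slab :: "nat \<Rightarrow> 'a set \<Rightarrow> 'a set" where
  "slab i A = {y. 0 \<le> bary i y \<and> bary i y \<le> 1 / sqrt (height_sq DIM('a)) \<and> proj i y \<in> A}"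

text \<open>Removing coordinate \<open>i\<close> along the altitude shares it out evenly among the
  other \<open>d\<close> coordinates. The cyclic billiard is computed entirely with this
  rule.\<close>

lemma bary_proj:
  assumes "i \<le> DIM('a)" "j \<le> DIM('a)"
  shows "bary j (proj i y) = (if j = i then 0 else bary j y + bary i y / real DIM('a))"
  using assms by (simp add: proj_def bary_diff blin_scaleR blin_altitude)

lemma borel_measurable_proj [measurable]: "proj i \<in> borel_measurable borel"
  unfolding proj_def by measurable

lemma sets_slab [measurable]: "A \<in> sets borel \<Longrightarrow> slab i A \<in> sets borel"
proof -
  assume A: "A \<in> sets borel"
  have "slab i A = {y. 0 \<le> bary i y \<and> bary i y \<le> 1 / sqrt (height_sq DIM('a))} \<inter> proj i -` A"
    by (auto simp: slab_def)
  also have "\<dots> \<in> sets borel"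
    by (intro sets.Int measurable_sets_borel[OF borel_measurable_proj A]) measurable
  finally show ?thesis .
qed

lemma sets_plane_measure [simp, measurable_cong]: "sets (plane_measure i) = sets borel"
  by (simp add: plane_measure_def hyperplane_lborel_def)

lemma space_plane_measure [simp]: "space (plane_measure i) = UNIV"
  by (simp add: plane_measure_def hyperplane_lborel_def)

text \<open>Turns questions about the measure on a hyperplane into questions about Lebesgue measure
  of slabs, where affine bijections of the space can act.\<close>

lemma emeasure_plane_measure:
  assumes i: "i \<le> DIM('a)" and A [measurable]: "A \<in> sets borel"
  shows "emeasure (plane_measure i) A = emeasure lborel (slab i A)"
proof -
  let ?h = "sqrt (height_sq DIM('a))"
  have h: "?h > 0" "?h * ?h = height_sq DIM('a)" using height_pos by auto
  have n: "(y - face_centroid w i) \<bullet> face_normal w i = bary i y * ?h" for y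
    using h i by (simp add: face_normal_eq bary_def blin_def field_simps)
  have p: "y - ((y - face_centroid w i) \<bullet> face_normal w i) *\<^sub>R face_normal w i = proj i y" for y
    using h i unfolding n by (simp add: face_normal_eq proj_def)
  have "emeasure (plane_measure i) A =
      emeasure (density lborel (indicator {y. 0 \<le> bary i y * ?h \<and> bary i y * ?h \<le> 1})) (proj i -` A)"
    unfolding plane_measure_def hyperplane_lborel_def p unfolding n
    by (subst emeasure_distr) auto
  also have "\<dots> = emeasure lborel ({y. 0 \<le> bary i y * ?h \<and> bary i y * ?h \<le> 1} \<inter> proj i -` A)"
  proof (rule emeasure_restricted)
    show "proj i -` A \<in> sets lborel"
      using measurable_sets_borel[OF borel_measurable_proj A] by simp
  qed measurable
  also have "{y. 0 \<le> bary i y * ?h \<and> bary i y * ?h \<le> 1} \<inter> proj i -` A = slab i A"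
    using h by (auto simp: slab_def zero_le_mult_iff field_simps)
  finally show ?thesis .
qed

lemma sets_face [measurable]: "face w i \<in> sets borel"
  unfolding face_def
  by (intro borel_closed compact_imp_closed finite_imp_compact_convex_hull) auto

lemma sets_faces_union [measurable]: "faces_union w \<in> sets borel"
  unfolding faces_union_def by measurable

lemma sets_rel_interior_face [measurable]:
  assumes "i \<le> DIM('a)" shows "rel_interior (face w i) \<in> sets borel"
proof -
  have "rel_interior (face w i) = {x. bary i x = 0 \<and> (\<forall>j\<in>{..DIM('a)}. j \<noteq> i \<longrightarrow> 0 < bary j x)}"
    using assms by (auto simp: in_rel_interior_face_iff)
  also have "\<dots> \<in> sets borel" by measurable
  finally show ?thesis .
qed

lemma plane_measure_face_finite:
  assumes i: "i \<le> DIM('a)"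
  shows "emeasure (plane_measure i) (face w i) < \<infinity>"
proof -
  have "compact (face w i)" unfolding face_def by (intro finite_imp_compact_convex_hull) auto
  then obtain B where B: "\<And>x. x \<in> face w i \<Longrightarrow> norm x \<le> B"
    using compact_imp_bounded bounded_iff by metis
  have "norm y \<le> B + 1" if y: "y \<in> slab i (face w i)" for y
  proof -
    have "y = proj i y + bary i y *\<^sub>R altitude i" by (simp add: proj_def)
    moreover have "norm (proj i y) \<le> B" using y B by (auto simp: slab_def)
    moreover have "norm (bary i y *\<^sub>R altitude i) \<le> 1"
      using y i height_pos by (simp add: slab_def norm_altitude field_simps)
    ultimately show ?thesis by (metis add_mono norm_triangle_ineq order_trans)
  qed
  then have "bounded (slab i (face w i))" by (auto simp: bounded_iff)
  then show ?thesis
    unfolding emeasure_plane_measure[OF i sets_face] by (rule emeasure_bounded_finite)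
qed

lemma plane_measure_face_pos:
  assumes i: "i \<le> DIM('a)"
  shows "emeasure (plane_measure i) (face w i) > 0"
proof -
  let ?h = "sqrt (height_sq DIM('a))"
  have h: "?h > 0" using height_pos by auto
  let ?U = "{y. 0 < bary i y \<and> bary i y < 1 / ?h \<and> (\<forall>j\<in>{..DIM('a)} - {i}. 0 < bary j (proj i y))}"
  have op: "open {y. 0 < bary j (proj i y)}" for j
    unfolding proj_def by (intro open_Collect_less continuous_intros)
  have "?U = {y. 0 < bary i y} \<inter> {y. bary i y < 1 / ?h} \<inter> (\<Inter>j\<in>{..DIM('a)} - {i}. {y. 0 < bary j (proj i y)})"
    by blast
  also have "open \<dots>"
    by (intro open_Int open_INT open_Collect_less continuous_intros op ballI) auto
  finally have op: "open ?U" .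
  \<comment> \<open>The point above the centroid at half the thickness of the slab; it shows that
    the open set is nonempty.\<close>
  define y where "y = face_centroid w i + (1 / (2 * ?h)) *\<^sub>R altitude i"
  have biy: "bary i y = 1 / (2 * ?h)"
    using i by (simp add: y_def bary_add blin_scaleR blin_altitude bary_face_centroid)
  then have "proj i y = face_centroid w i" by (simp add: proj_def biy y_def)
  then have "y \<in> ?U" using h i by (auto simp: biy bary_face_centroid field_simps)
  moreover have "?U \<subseteq> slab i (face w i)"
  proof
    fix y assume y: "y \<in> ?U"
    then have "\<forall>j\<le>DIM('a). 0 \<le> bary j (proj i y)"
      using i by (metis (no_types, lifting) DiffI atMost_iff bary_proj less_imp_le mem_Collect_eq order_refl singletonD)
    then show "y \<in> slab i (face w i)"
      using y i by (simp add: slab_def in_face_iff bary_proj)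
  qed
  ultimately have "emeasure lborel (slab i (face w i)) > 0"
    by (intro emeasure_lborel_pos[OF op]) auto
  then show ?thesis using i by (simp add: emeasure_plane_measure)
qed

text \<open>Pulled back by \<open>proj i\<close>, the equation becomes affine on the whole space,
  and the point \<open>x\<close> of the hyperplane witnesses that it is not trivial. Two terms are
  allowed in order to cover ties between two hitting times.\<close>

lemma plane_measure_null:
  assumes ij: "i \<le> DIM('a)" and x: "bary i x = 0" "\<alpha> * bary k x + \<beta> * bary l x \<noteq> 0"
  shows "{x. \<alpha> * bary k x + \<beta> * bary l x = 0} \<in> null_sets (plane_measure i)"
proof -
  \<comment> \<open>The gradient of the pulled back equation; \<open>b\<close> is its value at the
    origin.\<close>
  define a where "a = (1 / height_sq DIM('a)) *\<^sub>R
     (\<alpha> *\<^sub>R (altitude k - blin k (altitude i) *\<^sub>R altitude i) + \<beta> *\<^sub>R (altitude l - blin l (altitude i) *\<^sub>R altitude i))"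
  define b where "b = \<alpha> * bary k (proj i 0) + \<beta> * bary l (proj i 0)"
  have bl: "bary m y = bary m 0 + blin m y" for m y using bary_add[of m 0 y] by simp
  have eq: "\<alpha> * bary k (proj i y) + \<beta> * bary l (proj i y) = a \<bullet> y + b" for y
    unfolding a_def b_def proj_def bary_diff blin_scaleR bl[of _ y]
    by (simp add: blin_def[of _ y] inner_add_left inner_diff_left inner_commute[of y] field_simps)
  have "proj i x = x" using x by (simp add: proj_def)
  then have "a \<bullet> x + b \<noteq> 0" using x(2) eq[of x] by simp
  then have "{y. a \<bullet> y + b = 0} \<in> null_sets lborel" by (rule null_sets_affine_zero)
  moreover have "slab i {x. \<alpha> * bary k x + \<beta> * bary l x = 0} \<subseteq> {y. a \<bullet> y + b = 0}"
    by (auto simp: slab_def eq)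
  ultimately have "emeasure lborel (slab i {x. \<alpha> * bary k x + \<beta> * bary l x = 0}) = 0"
    by (metis (no_types, lifting) borel_measurable_bary emeasure_eq_0 null_setsD1 null_setsD2)
  then show ?thesis using ij by (intro null_setsI) (auto simp: emeasure_plane_measure)
qed

section \<open>Stationary vectors and measures with constant density on each face\<close>

lemma stationary_distribution:
  assumes P: "\<And>i j. i \<le> DIM('a) \<Longrightarrow> j \<le> DIM('a) \<Longrightarrow> 0 \<le> P i j"
    "\<And>i. i \<le> DIM('a) \<Longrightarrow> (\<Sum>j\<le>DIM('a). P i j) = (1::real)"
  obtains \<pi> where "\<And>i. i \<le> DIM('a) \<Longrightarrow> 0 \<le> \<pi> i" "(\<Sum>i\<le>DIM('a). \<pi> i) = 1"
    "\<And>j. j \<le> DIM('a) \<Longrightarrow> (\<Sum>i\<le>DIM('a). \<pi> i * P i j) = \<pi> j"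
proof -
  \<comment> \<open>The pyramid itself serves as the set of probability vectors, so that Brouwer's theorem applies.\<close>
  define f where "f x = (\<Sum>j\<le>DIM('a). (\<Sum>i\<le>DIM('a). bary i x * P i j) *\<^sub>R w j)" for x
  have s: "(\<Sum>j\<le>DIM('a). \<Sum>i\<le>DIM('a). bary i x * P i j) = 1" for x
    by (subst sum.swap) (simp add: P(2) sum_bary flip: sum_distrib_left)
  have bf: "bary j (f x) = (\<Sum>i\<le>DIM('a). bary i x * P i j)" if "j \<le> DIM('a)" for j x
    unfolding f_def by (rule bary_combination[OF s that])
  obtain x where x: "x \<in> pyramid w" "f x = x"
  proof (rule brouwer)
    show "compact (pyramid w)" unfolding pyramid_def by (intro finite_imp_compact_convex_hull) auto
    show "convex (pyramid w)" "pyramid w \<noteq> {}" by (auto simp: pyramid_def)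
    show "continuous_on (pyramid w) f" unfolding f_def by (intro continuous_intros)
    show "f \<in> pyramid w \<rightarrow> pyramid w"
      by (auto simp: in_pyramid_iff bf intro!: sum_nonneg mult_nonneg_nonneg P(1))
  qed
  show ?thesis
  proof (rule that)
    show "0 \<le> bary i x" if "i \<le> DIM('a)" for i using x(1) that by (simp add: in_pyramid_iff)
    show "(\<Sum>i\<le>DIM('a). bary i x) = 1" by (rule sum_bary)
    show "(\<Sum>i\<le>DIM('a). bary i x * P i j) = bary j x" if "j \<le> DIM('a)" for j
      using bf[OF that, of x] unfolding x(2) by (rule sym)
  qed
qed

text \<open>Weights equal to 1 give \<open>surface_measure\<close>; the invariant measure is another
  instance, with the weights as its densities.\<close>

definition weighted_surface :: "(nat \<Rightarrow> ennreal) \<Rightarrow> 'a measure" where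
  "weighted_surface a = measure_of (faces_union w) (sets (restrict_space borel (faces_union w)))
     (\<lambda>A. \<Sum>i\<le>DIM('a). a i * emeasure (plane_measure i) (A \<inter> face w i))"

lemma sets_weighted_surface [simp]:
  "sets (weighted_surface a) = sets (restrict_space borel (faces_union w))"
proof -
  have "space (restrict_space borel (faces_union w)) = faces_union w"
    by (simp add: space_restrict_space)
  from sets.sets_measure_of_eq[of "restrict_space borel (faces_union w)", unfolded this]
  show ?thesis unfolding weighted_surface_def .
qed

lemma space_weighted_surface [simp]: "space (weighted_surface a) = faces_union w"
  using sets_eq_imp_space_eq[OF sets_weighted_surface] by (simp add: space_restrict_space)

lemma emeasure_weighted_surface:
  assumes "A \<in> sets borel" "A \<subseteq> faces_union w"
  shows "emeasure (weighted_surface a) A = (\<Sum>i\<le>DIM('a). a i * emeasure (plane_measure i) (A \<inter> face w i))"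
proof (rule emeasure_measure_of[OF weighted_surface_def])
  let ?\<mu> = "\<lambda>A. \<Sum>i\<le>DIM('a). a i * emeasure (plane_measure i) (A \<inter> face w i)"
  show "sets (restrict_space borel (faces_union w)) \<subseteq> Pow (faces_union w)"
    by (auto simp: sets_restrict_space)
  show "A \<in> sets (weighted_surface a)" using assms by (auto simp: sets_restrict_space_iff)
  show "positive (sets (weighted_surface a)) ?\<mu>" by (auto simp: positive_def)
  show "countably_additive (sets (weighted_surface a)) ?\<mu>"
  proof (rule countably_additiveI)
    fix F :: "nat \<Rightarrow> 'a set"
    assume F: "range F \<subseteq> sets (weighted_surface a)" "disjoint_family F"
    then have "F n \<in> sets (restrict_space borel (faces_union w))" for n by auto
    then have Fb: "F n \<in> sets borel" for n by (simp add: sets_restrict_space_iff)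
    have "(\<Sum>n. ?\<mu> (F n)) = (\<Sum>i\<le>DIM('a). \<Sum>n. a i * emeasure (plane_measure i) (F n \<inter> face w i))"
      by (rule suminf_sum) auto
    also have "\<dots> = ?\<mu> (\<Union>n. F n)"
    proof (rule sum.cong)
      fix i
      have "(\<Sum>n. emeasure (plane_measure i) (F n \<inter> face w i)) = emeasure (plane_measure i) (\<Union>n. F n \<inter> face w i)"
        by (rule suminf_emeasure) (use Fb F(2) in \<open>auto simp: disjoint_family_on_def\<close>)
      then show "(\<Sum>n. a i * emeasure (plane_measure i) (F n \<inter> face w i)) = a i * emeasure (plane_measure i) ((\<Union>n. F n) \<inter> face w i)"
        by simp
    qed simp
    finally show "(\<Sum>n. ?\<mu> (F n)) = ?\<mu> (\<Union>n. F n)" .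
  qed
qed

lemma surface_measure_eq: "surface_measure w = weighted_surface (\<lambda>_. 1)"
  by (simp add: surface_measure_def weighted_surface_def plane_measure_def)

end

section \<open>Billiards satisfying the vertex condition\<close>

locale radial_billiard = equilateral_simplex w for w :: "nat \<Rightarrow> 'a::euclidean_space" +
  fixes v :: "nat \<Rightarrow> 'a"
  assumes blin_own: "\<And>i. i \<le> DIM('a) \<Longrightarrow> 0 < blin i (v i)"
    and blin_other: "\<And>i j. i \<le> DIM('a) \<Longrightarrow> j \<le> DIM('a) \<Longrightarrow> j \<noteq> i \<Longrightarrow> blin j (v i) < 0"
begin

definition hit :: "nat \<Rightarrow> nat \<Rightarrow> 'a \<Rightarrow> real" where
  "hit i j x = - bary j x / blin j (v i)"

text \<open>The affine projection along \<open>v i\<close> to the hyperplane of face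
  \<open>j\<close>, defined on the whole space. The proof uses it as the return map on
  \<open>cell i j\<close> only.\<close>

definition exit :: "nat \<Rightarrow> nat \<Rightarrow> 'a \<Rightarrow> 'a" where
  "exit i j x = x + hit i j x *\<^sub>R v i"

text \<open>The strict inequality excludes ties, which makes the cells of a face disjoint and sends
  them into relative interiors.\<close>

definition cell :: "nat \<Rightarrow> nat \<Rightarrow> 'a set" where
  "cell i j = {x \<in> rel_interior (face w i). \<forall>k\<in>{..DIM('a)} - {i, j}. hit i j x < hit i k x}"

definition first_hit :: "nat \<Rightarrow> 'a \<Rightarrow> real" where
  "first_hit i x = Min ((\<lambda>j. hit i j x) ` ({..DIM('a)} - {i}))"

lemma others_nonempty: "i \<le> DIM('a) \<Longrightarrow> {..DIM('a)} - {i} \<noteq> {}"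
proof -
  have "(if i = 0 then 1 else 0) \<in> {..DIM('a)} - {i}" by (simp add: Suc_le_eq)
  then show ?thesis by blast
qed

lemma bary_move:
  "bary k (x + t *\<^sub>R v i) = bary k x + t * blin k (v i)"
  by (simp add: bary_add blin_scaleR)

lemma bary_move_sign:
  assumes "i \<le> DIM('a)" "k \<le> DIM('a)" "k \<noteq> i"
  shows "0 < bary k (x + t *\<^sub>R v i) \<longleftrightarrow> t < hit i k x"
    and "bary k (x + t *\<^sub>R v i) = 0 \<longleftrightarrow> t = hit i k x"
  using blin_other[OF assms] unfolding bary_move hit_def by (auto simp: field_simps)

lemma hit_pos:
  assumes "i \<le> DIM('a)" "x \<in> rel_interior (face w i)" "j \<le> DIM('a)" "j \<noteq> i"
  shows "0 < hit i j x"
  using bary_move_sign(1)[of i j x 0] assms by (simp add: in_rel_interior_face_iff)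

lemma first_hit_le:
  assumes "j \<le> DIM('a)" "j \<noteq> i"
  shows "first_hit i x \<le> hit i j x"
  unfolding first_hit_def using assms by (intro Min_le) auto

lemma first_hit_attained:
  assumes "i \<le> DIM('a)"
  obtains j where "j \<le> DIM('a)" "j \<noteq> i" "first_hit i x = hit i j x"
proof -
  have "first_hit i x \<in> (\<lambda>j. hit i j x) ` ({..DIM('a)} - {i})"
    unfolding first_hit_def using others_nonempty[OF assms] by (intro Min_in) auto
  then show ?thesis using that by auto
qed

lemma first_hit_cell:
  assumes "j \<le> DIM('a)" "j \<noteq> i" "x \<in> cell i j"
  shows "first_hit i x = hit i j x"
  unfolding first_hit_def
proof (rule Min_eqI)
  show "hit i j x \<in> (\<lambda>j. hit i j x) ` ({..DIM('a)} - {i})" using assms by blast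
  show "hit i j x \<le> y" if "y \<in> (\<lambda>j. hit i j x) ` ({..DIM('a)} - {i})" for y
  proof -
    obtain k where "k \<in> {..DIM('a)} - {i}" "y = hit i k x" using \<open>y \<in> _\<close> by blast
    then show ?thesis using assms(3) by (cases "k = j") (auto simp: cell_def less_imp_le)
  qed
qed simp

lemma rel_interior_face_subset: "i \<le> DIM('a) \<Longrightarrow> rel_interior (face w i) \<subseteq> faces_union w"
  unfolding faces_union_def using rel_interior_subset by blast

lemma available_faces_rel_interior:
  assumes i: "i \<le> DIM('a)" and x: "x \<in> rel_interior (face w i)"
  shows "available_faces w v x = {i}"
proof -
  have "k \<in> available_faces w v x \<longleftrightarrow> k = i" for k
  proof -
    have "bary k x = 0 \<longleftrightarrow> k = i" if "k \<le> DIM('a)" for k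
      using that x i in_rel_interior_face_iff by fastforce
    then show ?thesis
      using available_faces_iff[of x k v] rel_interior_face_subset[OF i] x blin_own[OF i] i by auto
  qed
  then show ?thesis by auto
qed

text \<open>If coordinates \<open>i\<close> and \<open>j\<close> both vanish, \<open>v i\<close>
  decreases coordinate \<open>j\<close> and so leaves the pyramid at once. On such points
  \<open>return_map\<close> is the identity by convention.\<close>

lemma available_faces_skeleton:
  assumes x: "x \<in> faces_union w" "\<And>i. i \<le> DIM('a) \<Longrightarrow> x \<notin> rel_interior (face w i)"
  shows "available_faces w v x = {}"
proof (rule equals0I)
  fix i assume "i \<in> available_faces w v x"
  then have i: "i \<le> DIM('a)" "bary i x = 0" and dir: "\<forall>j\<le>DIM('a). bary j x = 0 \<longrightarrow> 0 < blin j (v i)"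
    using available_faces_iff[OF x(1)] by auto
  obtain j where "j \<le> DIM('a)" "j \<noteq> i" "\<not> 0 < bary j x"
    using x(2)[OF i(1)] i in_rel_interior_face_iff by blast
  moreover have "0 \<le> bary j x" using \<open>j \<le> DIM('a)\<close> x(1) by (simp add: in_faces_union_iff)
  ultimately show False using dir blin_other[OF i(1)] by fastforce
qed

text \<open>Coordinate \<open>i\<close> is positive at any positive time, so another one has to
  vanish. Each of the others decreases through 0, and the earliest zero decides.\<close>

lemma move_in_faces_union_iff:
  assumes i: "i \<le> DIM('a)" and x: "x \<in> rel_interior (face w i)" and t: "t > 0"
  shows "x + t *\<^sub>R v i \<in> faces_union w \<longleftrightarrow> t = first_hit i x"
proof -
  have own: "0 < bary i (x + t *\<^sub>R v i)"
    using x i t blin_own[OF i] by (simp add: bary_move in_rel_interior_face_iff)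
  have nonneg: "0 \<le> bary k (x + t *\<^sub>R v i) \<longleftrightarrow> t \<le> hit i k x" if "k \<le> DIM('a)" "k \<noteq> i" for k
    using bary_move_sign[OF i that, of x t] by linarith
  obtain j where j: "j \<le> DIM('a)" "j \<noteq> i" "first_hit i x = hit i j x"
    using first_hit_attained[OF i] by blast
  show ?thesis
  proof
    assume "x + t *\<^sub>R v i \<in> faces_union w"
    then obtain k where k: "k \<le> DIM('a)" "bary k (x + t *\<^sub>R v i) = 0"
      and all: "\<forall>j\<le>DIM('a). 0 \<le> bary j (x + t *\<^sub>R v i)"
      unfolding in_faces_union_iff by blast
    have "k \<noteq> i" using own k by auto
    then have "t = hit i k x" using k bary_move_sign(2)[OF i] by blast
    then have "first_hit i x \<le> t" using first_hit_le k \<open>k \<noteq> i\<close> by blast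
    moreover have "t \<le> first_hit i x" using all nonneg j by metis
    ultimately show "t = first_hit i x" by simp
  next
    assume t: "t = first_hit i x"
    have "0 \<le> bary k (x + t *\<^sub>R v i)" if "k \<le> DIM('a)" for k
      using nonneg[OF that] own first_hit_le[OF that] t by (cases "k = i") auto
    moreover have "bary j (x + t *\<^sub>R v i) = 0" using bary_move_sign(2)[OF i j(1,2)] t j by simp
    ultimately show "x + t *\<^sub>R v i \<in> faces_union w"
      unfolding in_faces_union_iff using j by blast
  qed
qed

lemma first_hit_pos:
  assumes "i \<le> DIM('a)" "x \<in> rel_interior (face w i)" shows "0 < first_hit i x"
  using first_hit_attained[OF assms(1)] hit_pos[OF assms] by metis

lemma return_map_rel_interior:
  assumes i: "i \<le> DIM('a)" and x: "x \<in> rel_interior (face w i)"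
  shows "return_map w v x = x + first_hit i x *\<^sub>R v i"
proof -
  have "velocity w v x = v i"
    by (simp add: velocity_def available_faces_rel_interior[OF assms] Least_equality)
  moreover have "flight_time w x (v i) = first_hit i x"
    using move_in_faces_union_iff[OF assms] first_hit_pos[OF assms] by (intro flight_timeI) auto
  ultimately show ?thesis
    by (simp add: return_map_def available_faces_rel_interior[OF assms])
qed

lemma return_map_cell:
  assumes "i \<le> DIM('a)" "j \<le> DIM('a)" "j \<noteq> i" "x \<in> cell i j"
  shows "return_map w v x = exit i j x"
  using return_map_rel_interior[OF assms(1)] first_hit_cell[OF assms(2-4)] assms(4)
  by (simp add: exit_def cell_def)

lemma return_map_in_faces_union:
  assumes "x \<in> faces_union w" shows "return_map w v x \<in> faces_union w"
proof (cases "\<exists>i\<le>DIM('a). x \<in> rel_interior (face w i)")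
  case True
  then show ?thesis
    using return_map_rel_interior move_in_faces_union_iff first_hit_pos by metis
next
  case False
  then show ?thesis using available_faces_skeleton assms by (auto simp: return_map_def)
qed

section \<open>Measurability of the return map\<close>

lemma borel_measurable_first_hit [measurable]: "first_hit i \<in> borel_measurable borel"
  unfolding first_hit_def hit_def by measurable

text \<open>A single expression for all cases, from which measurability can be read off: at most one
  indicator is nonzero, and none is on the points left fixed by convention.\<close>

lemma return_map_formula:
  assumes "x \<in> faces_union w"
  shows "return_map w v x =
    x + (\<Sum>i\<le>DIM('a). (indicator (rel_interior (face w i)) x * first_hit i x) *\<^sub>R v i)"
proof (cases "\<exists>i\<le>DIM('a). x \<in> rel_interior (face w i)")
  case True
  then obtain i where i: "i \<le> DIM('a)" "x \<in> rel_interior (face w i)" by blast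
  have "x \<notin> rel_interior (face w k)" if "k \<le> DIM('a)" "k \<noteq> i" for k
    using i that in_rel_interior_face_iff by fastforce
  then have "(\<Sum>k\<le>DIM('a). (indicator (rel_interior (face w k)) x * first_hit k x) *\<^sub>R v k)
      = (\<Sum>k\<le>DIM('a). if k = i then first_hit i x *\<^sub>R v i else 0)"
    by (intro sum.cong) (use i in \<open>auto simp: indicator_def\<close>)
  then show ?thesis using return_map_rel_interior[OF i] i by simp
next
  case False
  then have "(\<Sum>k\<le>DIM('a). (indicator (rel_interior (face w k)) x * first_hit k x) *\<^sub>R v k) = 0"
    by (intro sum.neutral) auto
  then show ?thesis using False available_faces_skeleton[OF assms] by (auto simp: return_map_def)
qed

lemma return_map_measurable:
  "return_map w v \<in> measurable (restrict_space borel (faces_union w)) (restrict_space borel (faces_union w))"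
proof (rule measurable_restrict_space2)
  show "return_map w v \<in> space (restrict_space borel (faces_union w)) \<rightarrow> faces_union w"
    using return_map_in_faces_union by (auto simp: space_restrict_space)
  have "(\<lambda>x. x + (\<Sum>i\<le>DIM('a). (indicator (rel_interior (face w i)) x * first_hit i x) *\<^sub>R v i)) \<in> borel_measurable borel"
    using sets_rel_interior_face
    by (intro borel_measurable_add borel_measurable_sum borel_measurable_scaleR borel_measurable_times
        borel_measurable_indicator borel_measurable_const borel_measurable_first_hit) auto
  then have "(\<lambda>x. x + (\<Sum>i\<le>DIM('a). (indicator (rel_interior (face w i)) x * first_hit i x) *\<^sub>R v i))
      \<in> borel_measurable (restrict_space borel (faces_union w))"
    by (rule measurable_restrict_space1)
  then show "return_map w v \<in> borel_measurable (restrict_space borel (faces_union w))"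
    by (subst measurable_cong) (simp_all add: space_restrict_space return_map_formula)
qed

section \<open>Transitions between faces\<close>

lemma sets_cell [measurable]:
  assumes "i \<le> DIM('a)" shows "cell i j \<in> sets borel"
proof -
  have "cell i j = rel_interior (face w i) \<inter> {x. \<forall>k\<in>{..DIM('a)} - {i, j}. hit i j x < hit i k x}"
    by (auto simp: cell_def)
  also have "\<dots> \<in> sets borel"
    unfolding hit_def by (intro sets.Int sets_rel_interior_face assms) measurable
  finally show ?thesis .
qed

lemma borel_measurable_exit [measurable]: "exit i j \<in> borel_measurable borel"
  unfolding exit_def hit_def by measurable

text \<open>Positivity of coordinate \<open>i\<close> of the exit point means
  \<open>0 < hit i j x\<close>, and that of coordinate \<open>k\<close> means
  \<open>hit i j x < hit i k x\<close>. The equivalence on the whole hyperplane makes the cell the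
  full preimage of the target face, so each branch is onto up to the boundary.\<close>

lemma exit_in_rel_interior_iff:
  assumes ij: "i \<le> DIM('a)" "j \<le> DIM('a)" "j \<noteq> i" and x: "bary i x = 0"
  shows "exit i j x \<in> rel_interior (face w j) \<longleftrightarrow> x \<in> cell i j"
proof -
  have zero: "bary j (exit i j x) = 0"
    using bary_move_sign(2)[OF ij] by (simp add: exit_def)
  have own: "0 < bary i (exit i j x) \<longleftrightarrow> 0 < hit i j x"
    using blin_own[OF ij(1)] x by (simp add: exit_def bary_move zero_less_mult_iff not_less)
  have other: "0 < bary k (exit i j x) \<longleftrightarrow> hit i j x < hit i k x" if "k \<le> DIM('a)" "k \<noteq> i" for k
    unfolding exit_def by (rule bary_move_sign(1)[OF ij(1) that])
  have pos: "0 < bary k x \<longleftrightarrow> 0 < hit i k x" if "k \<le> DIM('a)" "k \<noteq> i" for k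
    using bary_move_sign(1)[OF ij(1) that, of x 0] by simp
  show ?thesis
  proof
    assume "exit i j x \<in> rel_interior (face w j)"
    then have "0 < bary k (exit i j x)" if "k \<le> DIM('a)" "k \<noteq> j" for k
      using that ij in_rel_interior_face_iff by blast
    then have "0 < hit i j x" "\<And>k. k \<le> DIM('a) \<Longrightarrow> k \<noteq> i \<Longrightarrow> k \<noteq> j \<Longrightarrow> hit i j x < hit i k x"
      using own other ij by auto
    then show "x \<in> cell i j"
      \<comment> \<open>\<open>0 < hit i j x < hit i k x\<close> gives back positivity of coordinate
        \<open>k\<close> at the start.\<close>
      using pos ij x unfolding cell_def in_rel_interior_face_iff[OF ij(1)]
      by (auto intro: order.strict_trans)
  next
    assume c: "x \<in> cell i j"
    then have "0 < bary j x" using ij by (simp add: cell_def in_rel_interior_face_iff)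
    then have "0 < hit i j x" using pos ij by blast
    then show "exit i j x \<in> rel_interior (face w j)"
      unfolding in_rel_interior_face_iff[OF ij(2)] using c zero own other by (auto simp: cell_def)
  qed
qed

lemma transition_constant:
  assumes ij: "i \<le> DIM('a)" "j \<le> DIM('a)" "j \<noteq> i"
  obtains c where "0 \<le> c" "\<And>A. A \<in> sets borel \<Longrightarrow>
    emeasure (plane_measure i) (cell i j \<inter> exit i j -` A) =
    ennreal c * emeasure (plane_measure j) (A \<inter> rel_interior (face w j))"
proof -
  \<comment> \<open>\<open>G\<close> extends \<^term>\<open>exit i j\<close> from the hyperplane of face \<open>i\<close> to the whole space by sending the
    normal of face \<open>i\<close> to that of face \<open>j\<close>; it commutes with the orthogonal projections.\<close>
  define G where "G y = exit i j (proj i y) + bary i y *\<^sub>R altitude j" for y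
  define p where "p u = u - blin i u *\<^sub>R altitude i" for u
  define L where "L u = p u - (blin j (p u) / blin j (v i)) *\<^sub>R v i + blin i u *\<^sub>R altitude j" for u
  have lin_p: "linear p"
    by (rule linearI) (simp_all add: p_def blin_add blin_scaleR algebra_simps)
  have lin: "linear L"
    by (rule linearI) (simp_all add: L_def linear_add[OF lin_p] linear_scale[OF lin_p]
        blin_add blin_scaleR scaleR_add_left add_divide_distrib algebra_simps)
  have bl: "bary m y = bary m 0 + blin m y" for m y using bary_add[of m 0 y] by simp
  have proj_p: "proj i y = proj i 0 + p y" for y
    unfolding proj_def p_def bl[of i y] by (simp add: algebra_simps)
  have G_L: "G y = L y + G 0" for y
  proof -
    have h: "hit i j (proj i y) = hit i j (proj i 0) - blin j (p y) / blin j (v i)"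
      by (simp add: proj_p[of y] hit_def bary_add diff_divide_distrib)
    show ?thesis
      unfolding G_def exit_def L_def h bl[of i y] by (simp add: proj_p[of y] algebra_simps)
  qed
  have exit_j: "bary j (exit i j x) = 0" for x
    using bary_move_sign(2)[OF ij] by (simp add: exit_def)
  have bary_G: "bary j (G y) = bary i y" for y
    using ij by (simp add: G_def bary_add blin_scaleR blin_altitude exit_j)
  have proj_G: "proj j (G y) = exit i j (proj i y)" for y
    by (simp add: proj_def[of j] bary_G) (simp add: G_def)
  have proj_i: "bary i (proj i y) = 0" for y using ij by (simp add: bary_proj)
  \<comment> \<open>\<open>G\<close> carries \<open>bary i\<close> over to \<open>bary j\<close>.
    Coordinate \<open>i\<close> of the exit point determines the hitting time because
    \<open>blin i (v i)\<close> is nonzero, and the time determines the starting point.\<close>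
  have "inj G"
  proof (rule injI)
    fix y y' assume eq: "G y = G y'"
    have b: "bary i y = bary i y'" using bary_G eq by metis
    have e: "exit i j (proj i y) = exit i j (proj i y')" using proj_G eq by metis
    have "hit i j (proj i y) * blin i (v i) = bary i (exit i j (proj i y))" for y
      by (simp add: exit_def bary_move proj_i)
    then have "hit i j (proj i y) = hit i j (proj i y')"
      using e blin_own[OF ij(1)] by (metis less_irrefl mult_right_cancel)
    then have "proj i y = proj i y'" using e by (simp add: exit_def)
    then show "y = y'" using b by (simp add: proj_def)
  qed
  then obtain c where c: "0 \<le> c"
    "\<And>A. A \<in> sets borel \<Longrightarrow> emeasure lborel (G -` A) = ennreal c * emeasure lborel A"
    using affine_bijection_scales_lborel[OF lin G_L] by blast
  have "emeasure (plane_measure i) (cell i j \<inter> exit i j -` A) =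
      ennreal c * emeasure (plane_measure j) (A \<inter> rel_interior (face w j))"
    if A [measurable]: "A \<in> sets borel" for A
  proof -
    \<comment> \<open>\<open>bary_G\<close> matches the thickness of the slabs,
      \<open>proj_G\<close> their bases.\<close>
    have "G -` slab j (A \<inter> rel_interior (face w j)) = slab i (cell i j \<inter> exit i j -` A)"
      using exit_in_rel_interior_iff[OF ij proj_i] by (auto simp: slab_def bary_G proj_G)
    moreover have "A \<inter> rel_interior (face w j) \<in> sets borel"
      using ij by (intro sets.Int sets_rel_interior_face A)
    moreover have "cell i j \<inter> exit i j -` A \<in> sets borel"
      using ij measurable_sets_borel[OF borel_measurable_exit A] by (intro sets.Int sets_cell)
    ultimately show ?thesis
      using c(2)[of "slab j (A \<inter> rel_interior (face w j))"] ij by (simp add: emeasure_plane_measure)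
  qed
  then show ?thesis using that c(1) by blast
qed

text \<open>A point of the face outside all cells has a further vanishing coordinate or two equal
  hitting times. Both are linear conditions on coordinates that fail at some vertex of face
  \<open>i\<close>, hence null.\<close>

lemma AE_cell:
  assumes i: "i \<le> DIM('a)"
  shows "AE x in plane_measure i. x \<in> face w i \<longrightarrow> (\<exists>j\<in>{..DIM('a)} - {i}. x \<in> cell i j)"
proof -
  let ?J = "{..DIM('a)} - {i}"
  \<comment> \<open>\<open>?Z\<close> collects vanishing coordinates, padded with a zero term to fit
    \<open>plane_measure_null\<close>; \<open>?D\<close> collects ties
    \<open>hit i j x = hit i k x\<close>.\<close>
  let ?Z = "\<lambda>k. {x. 1 * bary k x + 0 * bary k x = 0}"
  let ?D = "\<lambda>j k. {x. (1 / blin j (v i)) * bary j x + (- (1 / blin k (v i))) * bary k x = 0}"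
  have Z: "?Z k \<in> null_sets (plane_measure i)" if "k \<in> ?J" for k
    using that i by (intro plane_measure_null[of i "w k"]) (auto simp: bary_vertex)
  have D: "?D j k \<in> null_sets (plane_measure i)" if "j \<in> ?J" "k \<in> ?J" "j \<noteq> k" for j k
    using that i blin_other[of i j]
    by (intro plane_measure_null[of i "w j"]) (auto simp: bary_vertex)
  have "(\<Union>k\<in>?J. ?Z k) \<union> (\<Union>j\<in>?J. \<Union>k\<in>?J - {j}. ?D j k) \<in> null_sets (plane_measure i)"
    using Z D by (intro null_sets.Un null_sets.finite_UN) auto
  moreover have "{x. \<not> (x \<in> face w i \<longrightarrow> (\<exists>j\<in>?J. x \<in> cell i j))}
      \<subseteq> (\<Union>k\<in>?J. ?Z k) \<union> (\<Union>j\<in>?J. \<Union>k\<in>?J - {j}. ?D j k)"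
  proof
    fix x assume "x \<in> {x. \<not> (x \<in> face w i \<longrightarrow> (\<exists>j\<in>?J. x \<in> cell i j))}"
    then have x: "bary i x = 0" "\<forall>j\<le>DIM('a). 0 \<le> bary j x" and nc: "\<And>j. j \<in> ?J \<Longrightarrow> x \<notin> cell i j"
      using i by (auto simp: in_face_iff)
    show "x \<in> (\<Union>k\<in>?J. ?Z k) \<union> (\<Union>j\<in>?J. \<Union>k\<in>?J - {j}. ?D j k)"
    proof (cases "\<exists>k\<in>?J. bary k x = 0")
      case True then show ?thesis by auto
    next
      case False
      have "x \<in> rel_interior (face w i)"
        using False x i unfolding in_rel_interior_face_iff[OF i]
        by (metis Diff_iff atMost_iff order_less_le singletonD)
      moreover obtain j where j: "j \<le> DIM('a)" "j \<noteq> i" "first_hit i x = hit i j x"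
        using first_hit_attained[OF i] by blast
      ultimately obtain k where k: "k \<in> ?J" "k \<noteq> j" "\<not> hit i j x < hit i k x"
        using nc[of j] by (auto simp: cell_def)
      moreover have "hit i j x \<le> hit i k x" using first_hit_le[of k i x] k(1) j by simp
      ultimately have "hit i j x = hit i k x" by simp
      then have "x \<in> ?D j k" by (simp add: hit_def)
      then show ?thesis using j k by blast
    qed
  qed
  ultimately show ?thesis by (intro AE_I') auto
qed

lemma AE_rel_interior_face:
  assumes i: "i \<le> DIM('a)"
  shows "AE x in plane_measure i. x \<in> face w i \<longrightarrow> x \<in> rel_interior (face w i)"
  using AE_cell[OF i] by eventually_elim (auto simp: cell_def)

text \<open>The cells are disjoint and exhaust face \<open>i\<close> up to a null set, so the
  preimage splits into one piece per target face, and the factors \<open>c j\<close> apply piece by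
  piece.\<close>

lemma emeasure_preimage_face:
  assumes i: "i \<le> DIM('a)"
    and c: "\<And>j A. j \<in> {..DIM('a)} - {i} \<Longrightarrow> A \<in> sets borel \<Longrightarrow>
      emeasure (plane_measure i) (cell i j \<inter> exit i j -` A) =
      ennreal (c j) * emeasure (plane_measure j) (A \<inter> rel_interior (face w j))"
    and A: "A \<in> sets borel" "A \<subseteq> faces_union w"
  shows "emeasure (plane_measure i) (return_map w v -` A \<inter> faces_union w \<inter> face w i) =
    (\<Sum>j\<in>{..DIM('a)} - {i}. ennreal (c j) * emeasure (plane_measure j) (A \<inter> face w j))"
proof -
  let ?J = "{..DIM('a)} - {i}"
  let ?B = "return_map w v -` A \<inter> faces_union w"
  have "?B \<in> sets (restrict_space borel (faces_union w))"
    using measurable_sets[OF return_map_measurable, of A] A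
    by (simp add: sets_restrict_space_iff space_restrict_space)
  then have B: "?B \<in> sets borel" by (simp add: sets_restrict_space_iff)
  have C: "cell i j \<inter> exit i j -` A \<in> sets borel" for j
    using i measurable_sets_borel[OF borel_measurable_exit A(1)] by (intro sets.Int sets_cell)
  have face_sub: "face w i \<subseteq> faces_union w" using i by (auto simp: faces_union_def)
  have cell_face: "cell i j \<subseteq> face w i" for j
    using rel_interior_subset by (auto simp: cell_def)
  have "emeasure (plane_measure i) (?B \<inter> face w i)
      = emeasure (plane_measure i) (\<Union>j\<in>?J. cell i j \<inter> exit i j -` A)"
  proof (rule emeasure_eq_AE)
    show "AE x in plane_measure i. x \<in> ?B \<inter> face w i \<longleftrightarrow> x \<in> (\<Union>j\<in>?J. cell i j \<inter> exit i j -` A)"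
      using AE_cell[OF i]
    proof eventually_elim
      case (elim x)
      show ?case
      proof (cases "\<exists>j\<in>?J. x \<in> cell i j")
        case True
        have "x \<in> ?B \<inter> face w i \<longleftrightarrow> return_map w v x \<in> A"
          using True cell_face face_sub by auto
        moreover have T: "return_map w v x = exit i j x" if "x \<in> cell i j" "j \<in> ?J" for j
          using return_map_cell[OF i] that by auto
        moreover have "return_map w v x \<in> A \<longleftrightarrow> x \<in> (\<Union>j\<in>?J. cell i j \<inter> exit i j -` A)"
        proof
          assume "return_map w v x \<in> A"
          then show "x \<in> (\<Union>j\<in>?J. cell i j \<inter> exit i j -` A)"
            using True T by fastforce
        next
          assume "x \<in> (\<Union>j\<in>?J. cell i j \<inter> exit i j -` A)"
          then obtain j where "j \<in> ?J" "x \<in> cell i j" "exit i j x \<in> A" by blast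
          then show "return_map w v x \<in> A" using T by simp
        qed
        ultimately show ?thesis by blast
      next
        case False then show ?thesis using elim by auto
      qed
    qed
    show "?B \<inter> face w i \<in> sets (plane_measure i)" using B sets_face by simp
    show "(\<Union>j\<in>?J. cell i j \<inter> exit i j -` A) \<in> sets (plane_measure i)"
      using C by auto
  qed
  also have "\<dots> = (\<Sum>j\<in>?J. emeasure (plane_measure i) (cell i j \<inter> exit i j -` A))"
  proof (rule sum_emeasure[symmetric])
    show "disjoint_family_on (\<lambda>j. cell i j \<inter> exit i j -` A) ?J"
      unfolding disjoint_family_on_def cell_def by (auto intro: order.asym)
  qed (use C in auto)
  also have "\<dots> = (\<Sum>j\<in>?J. ennreal (c j) * emeasure (plane_measure j) (A \<inter> face w j))"
  proof (rule sum.cong)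
    fix j assume j: "j \<in> ?J"
    then have jd: "j \<le> DIM('a)" by simp
    have "emeasure (plane_measure j) (A \<inter> rel_interior (face w j)) = emeasure (plane_measure j) (A \<inter> face w j)"
    proof (rule emeasure_eq_AE)
      show "AE x in plane_measure j. x \<in> A \<inter> rel_interior (face w j) \<longleftrightarrow> x \<in> A \<inter> face w j"
        using AE_rel_interior_face[OF jd]
        by eventually_elim (use rel_interior_subset in auto)
    qed (use A(1) sets_face sets_rel_interior_face[OF jd] in auto)
    then show "emeasure (plane_measure i) (cell i j \<inter> exit i j -` A) = ennreal (c j) * emeasure (plane_measure j) (A \<inter> face w j)"
      using c[OF j A(1)] by simp
  qed simp
  finally show ?thesis .
qed

lemma radial_billiard_strongly_chaotic: "strongly_chaotic w v"
proof -
  let ?D = "{..DIM('a)}"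
  let ?\<mu> = plane_measure
  have "\<exists>c. \<forall>j\<in>?D - {i}. 0 \<le> c j \<and> (\<forall>A\<in>sets borel. emeasure (?\<mu> i) (cell i j \<inter> exit i j -` A)
      = ennreal (c j) * emeasure (?\<mu> j) (A \<inter> rel_interior (face w j)))" if i: "i \<le> DIM('a)" for i
  proof (intro bchoice ballI)
    fix j assume "j \<in> ?D - {i}"
    then have "j \<le> DIM('a)" "j \<noteq> i" by auto
    then show "\<exists>c\<ge>0. \<forall>A\<in>sets borel. emeasure (?\<mu> i) (cell i j \<inter> exit i j -` A)
      = ennreal c * emeasure (?\<mu> j) (A \<inter> rel_interior (face w j))"
      using transition_constant[OF i] by metis
  qed
  then obtain c where c: "\<And>i j. i \<le> DIM('a) \<Longrightarrow> j \<in> ?D - {i} \<Longrightarrow> 0 \<le> c i j"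
    "\<And>i j A. i \<le> DIM('a) \<Longrightarrow> j \<in> ?D - {i} \<Longrightarrow> A \<in> sets borel \<Longrightarrow>
      emeasure (?\<mu> i) (cell i j \<inter> exit i j -` A) = ennreal (c i j) * emeasure (?\<mu> j) (A \<inter> rel_interior (face w j))"
    by metis
  \<comment> \<open>Extended by 0 on the diagonal, since no branch leads from a face to itself; sums
    then run over all indices.\<close>
  define c' where "c' i j = (if j = i then 0 else c i j)" for i j
  have c'_nonneg: "0 \<le> c' i j" if "i \<le> DIM('a)" "j \<le> DIM('a)" for i j
    using c(1)[of i j] that by (simp add: c'_def)
  have step: "emeasure (?\<mu> i) (return_map w v -` A \<inter> faces_union w \<inter> face w i) =
      (\<Sum>j\<le>DIM('a). ennreal (c' i j) * emeasure (?\<mu> j) (A \<inter> face w j))"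
    if "i \<le> DIM('a)" "A \<in> sets borel" "A \<subseteq> faces_union w" for i A
  proof -
    have "(\<Sum>j\<le>DIM('a). ennreal (c' i j) * emeasure (?\<mu> j) (A \<inter> face w j))
        = (\<Sum>j\<in>?D - {i}. ennreal (c i j) * emeasure (?\<mu> j) (A \<inter> face w j))"
      by (rule sum.mono_neutral_cong_right) (auto simp: c'_def)
    moreover have "emeasure (?\<mu> i) (return_map w v -` A \<inter> faces_union w \<inter> face w i) =
        (\<Sum>j\<in>?D - {i}. ennreal (c i j) * emeasure (?\<mu> j) (A \<inter> face w j))"
      by (rule emeasure_preimage_face) (fact that c(2)[OF that(1)])+
    ultimately show ?thesis by simp
  qed
  define F where "F i = enn2real (emeasure (?\<mu> i) (face w i))" for i
  have F: "emeasure (?\<mu> i) (face w i) = ennreal (F i)" "0 < F i" if "i \<le> DIM('a)" for i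
    using plane_measure_face_finite[OF that] plane_measure_face_pos[OF that]
    by (auto simp: F_def enn2real_positive_iff)
  \<comment> \<open>The instance \<open>A = faces_union w\<close> of \<open>step\<close>: the return
    map stays on the surface, so the whole face is the preimage. Hence
    \<open>c' i j * F j / F i\<close>, the fraction of face \<open>i\<close> that moves to face
    \<open>j\<close>, is a stochastic matrix.\<close>
  have rows: "(\<Sum>j\<le>DIM('a). c' i j * F j) = F i" if i: "i \<le> DIM('a)" for i
  proof -
    have face_sub: "face w j \<subseteq> faces_union w" if "j \<le> DIM('a)" for j
      using that by (auto simp: faces_union_def)
    have "return_map w v -` faces_union w \<inter> faces_union w \<inter> face w i = face w i"
      using return_map_in_faces_union face_sub[OF i] by auto
    then have "ennreal (F i) = (\<Sum>j\<le>DIM('a). ennreal (c' i j) * emeasure (?\<mu> j) (faces_union w \<inter> face w j))"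
      using step[OF i sets_faces_union] F(1)[OF i] by simp
    also have "\<dots> = (\<Sum>j\<le>DIM('a). ennreal (c' i j * F j))"
      using F c'_nonneg i face_sub by (intro sum.cong) (auto simp: ennreal_mult Int_absorb1 less_imp_le)
    also have "\<dots> = ennreal (\<Sum>j\<le>DIM('a). c' i j * F j)"
      using F c'_nonneg i by (intro sum_ennreal) (auto simp: less_imp_le)
    finally show ?thesis
      using F(2) c'_nonneg i by (subst (asm) ennreal_inj) (auto intro!: sum_nonneg simp: less_imp_le)
  qed
  obtain \<pi> where pi: "\<And>i. i \<le> DIM('a) \<Longrightarrow> 0 \<le> \<pi> i" "(\<Sum>i\<le>DIM('a). \<pi> i) = 1"
    "\<And>j. j \<le> DIM('a) \<Longrightarrow> (\<Sum>i\<le>DIM('a). \<pi> i * (c' i j * F j / F i)) = \<pi> j"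
  proof (rule stationary_distribution[of "\<lambda>i j. c' i j * F j / F i"])
    show "0 \<le> c' i j * F j / F i" if "i \<le> DIM('a)" "j \<le> DIM('a)" for i j
      using that F(2) c'_nonneg by (simp add: less_imp_le)
    show "(\<Sum>j\<le>DIM('a). c' i j * F j / F i) = 1" if "i \<le> DIM('a)" for i
      using rows[OF that] F(2)[OF that] by (simp flip: sum_divide_distrib)
  qed blast
  \<comment> \<open>\<open>\<pi> i\<close> is the mass of face \<open>i\<close> and
    \<open>F i\<close> its area, so \<open>a i\<close> is the density on that face.\<close>
  define a where "a i = \<pi> i / F i" for i
  have a_nonneg: "0 \<le> a i" if "i \<le> DIM('a)" for i
    using pi(1) F(2) that by (simp add: a_def less_imp_le)
  have a_stationary: "(\<Sum>i\<le>DIM('a). a i * c' i j) = a j" if "j \<le> DIM('a)" for j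
  proof -
    have "(\<Sum>i\<le>DIM('a). a i * c' i j) = (\<Sum>i\<le>DIM('a). \<pi> i * (c' i j * F j / F i)) / F j"
      unfolding sum_divide_distrib
      by (rule sum.cong) (use F(2)[OF that] in \<open>auto simp: a_def\<close>)
    then show ?thesis using pi(3)[OF that] by (simp add: a_def)
  qed
  define M where "M = weighted_surface (\<lambda>i. ennreal (a i))"
  have emM: "emeasure M A = (\<Sum>i\<le>DIM('a). ennreal (a i) * emeasure (?\<mu> i) (A \<inter> face w i))"
    if "A \<in> sets borel" "A \<subseteq> faces_union w" for A
    unfolding M_def by (rule emeasure_weighted_surface[OF that])
  have setsM: "sets M = sets (restrict_space borel (faces_union w))" by (simp add: M_def)
  have spaceM: "space M = faces_union w" by (simp add: M_def)
  have inM: "A \<in> sets M \<longleftrightarrow> A \<in> sets borel \<and> A \<subseteq> faces_union w" for A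
    unfolding setsM by (auto simp: sets_restrict_space_iff)
  have T: "return_map w v \<in> measurable M M"
    using return_map_measurable unfolding measurable_cong_sets[OF setsM setsM] .
  have "prob_space M"
  proof
    have "emeasure M (space M) = (\<Sum>i\<le>DIM('a). ennreal (\<pi> i))"
      unfolding spaceM emM[OF sets_faces_union subset_refl]
    proof (rule sum.cong)
      fix i assume "i \<in> ?D"
      then have i: "i \<le> DIM('a)" by simp
      have "faces_union w \<inter> face w i = face w i" using i by (auto simp: faces_union_def)
      moreover have "ennreal (a i) * ennreal (F i) = ennreal (\<pi> i)"
        using F(2)[OF i] a_nonneg[OF i] by (simp add: a_def flip: ennreal_mult)
      ultimately show "ennreal (a i) * emeasure (?\<mu> i) (faces_union w \<inter> face w i) = ennreal (\<pi> i)"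
        using F(1)[OF i] by simp
    qed simp
    also have "\<dots> = ennreal 1" using pi by (subst sum_ennreal) auto
    finally show "emeasure M (space M) = 1" by simp
  qed
  moreover have "distr M M (return_map w v) = M"
  proof (rule measure_eqI)
    fix A assume "A \<in> sets (distr M M (return_map w v))"
    then have A: "A \<in> sets borel" "A \<subseteq> faces_union w" and AM: "A \<in> sets M" using inM by auto
    have "return_map w v -` A \<inter> faces_union w \<in> sets M"
      using measurable_sets[OF T AM] by (simp add: spaceM)
    then have "emeasure (distr M M (return_map w v)) A =
        (\<Sum>i\<le>DIM('a). ennreal (a i) * emeasure (?\<mu> i) (return_map w v -` A \<inter> faces_union w \<inter> face w i))"
      using emM[of "return_map w v -` A \<inter> faces_union w"] inM by (simp add: emeasure_distr[OF T AM] spaceM)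
    also have "\<dots> = (\<Sum>i\<le>DIM('a). \<Sum>j\<le>DIM('a). ennreal (a i * c' i j) * emeasure (?\<mu> j) (A \<inter> face w j))"
      using A a_nonneg c'_nonneg
      by (intro sum.cong) (simp_all add: step sum_distrib_left ennreal_mult mult.assoc)
    also have "\<dots> = (\<Sum>j\<le>DIM('a). ennreal (a j) * emeasure (?\<mu> j) (A \<inter> face w j))"
    proof (subst sum.swap, rule sum.cong)
      fix j assume j: "j \<in> ?D"
      have "(\<Sum>i\<le>DIM('a). ennreal (a i * c' i j)) = ennreal (\<Sum>i\<le>DIM('a). a i * c' i j)"
        using a_nonneg c'_nonneg j by (intro sum_ennreal) auto
      then show "(\<Sum>i\<le>DIM('a). ennreal (a i * c' i j) * emeasure (?\<mu> j) (A \<inter> face w j))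
          = ennreal (a j) * emeasure (?\<mu> j) (A \<inter> face w j)"
        using a_stationary j by (simp flip: sum_distrib_right)
    qed simp
    finally show "emeasure (distr M M (return_map w v)) A = emeasure M A" using emM[OF A] by simp
  qed simp
  \<comment> \<open>A null set of \<open>surface_measure\<close> is null on every face, and
    reweighting the faces preserves this.\<close>
  moreover have "absolutely_continuous (surface_measure w) M"
    unfolding absolutely_continuous_def
  proof
    fix A assume "A \<in> null_sets (surface_measure w)"
    then have A: "A \<in> sets M" "emeasure (surface_measure w) A = 0"
      by (auto simp: setsM surface_measure_eq)
    then have "(\<Sum>i\<le>DIM('a). emeasure (?\<mu> i) (A \<inter> face w i)) = 0"
      using inM by (simp add: surface_measure_eq emeasure_weighted_surface)
    then have "emeasure M A = 0" using A(1) inM by (simp add: emM)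
    then show "A \<in> null_sets M" using A(1) by auto
  qed
  ultimately show ?thesis unfolding strongly_chaotic_def using setsM T by blast
qed

end

text \<open>At the centroid of face \<open>i\<close> only coordinate \<open>i\<close> vanishes, so
  directedness there gives the sign of \<open>blin i (v i)\<close>. Moving from \<open>w i\<close>
  to its face lowers coordinate \<open>i\<close> from 1 to 0, which forces \<open>s < 0\<close>; the
  other coordinates rise from 0, so their rates along \<open>v i\<close> are negative.\<close>

lemma radial_billiardI:
  fixes w v :: "nat \<Rightarrow> 'a::euclidean_space"
  assumes model: "standard_model w v" and vertex: "vertex_line_condition w v"
  shows "radial_billiard w v"
proof -
  interpret equilateral_simplex w
    by unfold_locales (use model in \<open>simp add: standard_model_def\<close>)
  have own: "0 < blin i (v i)" if i: "i \<le> DIM('a)" for i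
  proof -
    let ?x = "face_centroid w i"
    have "directed_into w ?x (v i)"
      using model i face_centroid_in_rel_interior[OF i] by (simp add: standard_model_def)
    moreover have "\<forall>j\<le>DIM('a). 0 \<le> bary j ?x" using i by (simp add: bary_face_centroid)
    ultimately have "\<forall>j\<le>DIM('a). bary j ?x = 0 \<longrightarrow> 0 < blin j (v i)"
      by (simp add: directed_into_iff)
    then show ?thesis using i by (simp add: bary_face_centroid)
  qed
  have "blin j (v i) < 0" if i: "i \<le> DIM('a)" and j: "j \<le> DIM('a)" "j \<noteq> i" for i j
  proof -
    obtain s where "w i + s *\<^sub>R v i \<in> rel_interior (face w i)"
      using vertex i by (auto simp: vertex_line_condition_def)
    then have "1 + s * blin i (v i) = 0" "0 < s * blin j (v i)"
      using i j by (auto simp: in_rel_interior_face_iff bary_add blin_scaleR bary_vertex)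
    moreover from this have "\<not> 0 < s" using mult_pos_pos[OF _ own[OF i], of s] by linarith
    ultimately show ?thesis by (auto simp: zero_less_mult_iff)
  qed
  then show ?thesis using own by unfold_locales auto
qed

section \<open>A billiard with a globally stable periodic orbit\<close>

text \<open>Orthonormal vectors scaled by \<open>1 / sqrt 2\<close> have mutual distance 1 and give
  \<open>d\<close> vertices; the last vertex lies on the diagonal.\<close>

lemma exists_equilateral_simplex: "\<exists>w :: nat \<Rightarrow> 'a::euclidean_space. equilateral_simplex w"
proof -
  let ?d = "real DIM('a)"
  obtain e :: "nat \<Rightarrow> 'a" where e: "bij_betw e {0..<DIM('a)} Basis"
    using ex_bij_betw_nat_finite[OF finite_Basis] by blast
  have eB: "e i \<in> Basis" if "i < DIM('a)" for i using e that by (auto simp: bij_betw_def)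
  have ee: "e i \<bullet> e j = (if i = j then 1 else 0)" if "i < DIM('a)" "j < DIM('a)" for i j
    using e that eB by (auto simp: inner_Basis bij_betw_def inj_on_def)
  \<comment> \<open>The larger root of \<open>d * c^2 - sqrt 2 * c = 1/2\<close>, which says that
    \<open>c *\<^sub>R \<Sum>Basis\<close> has distance 1 from the other vertices.\<close>
  define c where "c = (sqrt 2 + sqrt (2 + 2 * ?d)) / (2 * ?d)"
  have c: "?d * c\<^sup>2 - sqrt 2 * c = 1 / 2"
  proof -
    have "2 * ?d * c - sqrt 2 = sqrt (2 + 2 * ?d)" by (simp add: c_def)
    then have "(2 * ?d * c - sqrt 2)\<^sup>2 = 2 + 2 * ?d" by simp
    then have "4 * ?d * (?d * c\<^sup>2 - sqrt 2 * c) = 4 * ?d * (1 / 2)"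
      by (simp add: power2_eq_square algebra_simps)
    then show ?thesis by simp
  qed
  define w where "w i = (if i < DIM('a) then (1 / sqrt 2) *\<^sub>R e i else c *\<^sub>R \<Sum>Basis)" for i
  have "dist (w i) (w j) = 1" if "i \<le> DIM('a)" "j \<le> DIM('a)" "i < j" for i j
  proof -
    have i: "i < DIM('a)" using that by simp
    have "(w i - w j) \<bullet> (w i - w j) = 1"
    proof (cases "j < DIM('a)")
      case True
      then show ?thesis using i that
        by (simp add: w_def inner_diff_left inner_diff_right ee inner_commute real_sqrt_mult_self flip: real_sqrt_mult)
    next
      case False
      have one: "b \<bullet> \<Sum>Basis = 1" if "b \<in> Basis" for b :: 'a
      proof -
        have "b \<bullet> \<Sum>Basis = (\<Sum>b'\<in>Basis. if b = b' then 1 else 0)"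
          unfolding inner_sum_right by (rule sum.cong) (use that in \<open>auto simp: inner_Basis\<close>)
        then show ?thesis using that by simp
      qed
      define B :: 'a where "B = \<Sum>Basis"
      have s: "e i \<bullet> B = 1" unfolding B_def by (rule one[OF eB[OF i]])
      have "B \<bullet> B = (\<Sum>b\<in>Basis. b \<bullet> (\<Sum>Basis::'a))" unfolding B_def by (rule inner_sum_left)
      also have "\<dots> = (\<Sum>b\<in>(Basis::'a set). 1)" by (rule sum.cong[OF refl one])
      finally have t: "B \<bullet> B = ?d" by simp
      have w_ij: "w i = (1 / sqrt 2) *\<^sub>R e i" "w j = c *\<^sub>R B"
        using False i by (simp_all add: w_def B_def)
      have "(w i - w j) \<bullet> (w i - w j) = 1 / 2 - 2 * (c / sqrt 2) + c * c * ?d"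
        unfolding w_ij using s s[unfolded inner_commute[of "e i"]] t ee[OF i i]
        by (simp add: inner_diff_left inner_diff_right) (simp add: diff_divide_distrib algebra_simps)
      also have "\<dots> = 1 / 2 + (?d * c\<^sup>2 - sqrt 2 * c)"
        by (simp add: power2_eq_square real_div_sqrt field_simps)
      finally show ?thesis using c by simp
    qed
    then show ?thesis by (simp add: dist_norm norm_eq_sqrt_inner)
  qed
  then have "equilateral_simplex w"
    by unfold_locales (metis dist_commute linorder_neqE_nat)
  then show ?thesis by blast
qed

context equilateral_simplex
begin

definition cyc :: "nat \<Rightarrow> nat" where
  "cyc i = (if i = DIM('a) then 0 else Suc i)"

text \<open>The number of cyclic steps from \<open>l\<close> to \<open>i\<close>.\<close>
definition gap :: "nat \<Rightarrow> nat \<Rightarrow> nat" where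
  "gap i l = (if l \<le> i then i - l else i + Suc DIM('a) - l)"

text \<open>\<open>face_normal\<close> points from a face towards the opposite vertex; the minus
  sign makes it outward.\<close>

definition cyclic_field :: "nat \<Rightarrow> 'a" where
  "cyclic_field i = - face_normal w (cyc i)"

abbreviation T :: "'a \<Rightarrow> 'a" where
  "T \<equiv> return_map w cyclic_field"

text \<open>Coordinate \<open>l\<close> counts the steps since face \<open>l\<close> was visited.
  Projecting to face \<open>cyc i\<close> removes the largest counter, \<open>d\<close> units, and
  gives one unit to each of the other \<open>d\<close> coordinates, so all counters advance by one.
  The normalization is the sum \<open>0 + ... + d = d * (d + 1) / 2\<close>.\<close>

definition orbit_point :: "nat \<Rightarrow> 'a" where
  "orbit_point i = (\<Sum>l\<le>DIM('a). (2 * real (gap i l) / (real DIM('a) * real (Suc DIM('a)))) *\<^sub>R w l)"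

lemma cyc_le: "i \<le> DIM('a) \<Longrightarrow> cyc i \<le> DIM('a)"
  and cyc_neq: "cyc i \<noteq> i"
  using DIM_positive[where 'a='a] by (auto simp: cyc_def)

section \<open>Cyclic indices and the explicit orbit\<close>

lemma funpow_cyc:
  assumes "i \<le> DIM('a)" "m \<le> Suc DIM('a)"
  shows "(cyc ^^ m) i = (if i + m \<le> DIM('a) then i + m else i + m - Suc DIM('a))"
  using assms(2) by (induction m) (use assms(1) in \<open>auto simp: cyc_def\<close>)

lemma funpow_cyc_le: "i \<le> DIM('a) \<Longrightarrow> (cyc ^^ m) i \<le> DIM('a)"
  by (induction m) (auto simp: cyc_le)

lemma funpow_cyc_reaches:
  assumes "i \<le> DIM('a)" "l \<le> DIM('a)"
  obtains m where "m \<in> {1..Suc DIM('a)}" "(cyc ^^ m) i = l"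
proof -
  \<comment> \<open>For \<open>l = i\<close> a full turn of \<open>Suc d\<close> steps is taken
    instead of 0, because the convergence of coordinates below starts at one step ahead.\<close>
  define m where "m = (if i < l then l - i else l + Suc DIM('a) - i)"
  have "m \<in> {1..Suc DIM('a)}" using assms by (auto simp: m_def)
  moreover have "(cyc ^^ m) i = l"
    using assms by (subst funpow_cyc) (auto simp: m_def)
  ultimately show ?thesis using that by blast
qed

lemma gap_self: "gap i i = 0"
  and gap_pos: "l \<le> DIM('a) \<Longrightarrow> l \<noteq> i \<Longrightarrow> 0 < gap i l"
  and gap_le: "i \<le> DIM('a) \<Longrightarrow> gap i l \<le> DIM('a)"
  and gap_gap: "l \<le> DIM('a) \<Longrightarrow> i \<le> DIM('a) \<Longrightarrow> gap i (gap i l) = l"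
  by (auto simp: gap_def)

lemma gap_cyc:
  assumes "i \<le> DIM('a)" "l \<le> DIM('a)"
  shows "gap (cyc i) l = (if l = cyc i then 0 else Suc (gap i l))"
  using assms by (auto simp: gap_def cyc_def)

lemma bary_orbit_point:
  assumes i: "i \<le> DIM('a)" and l: "l \<le> DIM('a)"
  shows "bary l (orbit_point i) = 2 * real (gap i l) / (real DIM('a) * real (Suc DIM('a)))"
  unfolding orbit_point_def
proof (rule bary_combination[OF _ l])
  have "(\<Sum>l\<le>DIM('a). real (gap i l)) = (\<Sum>l\<le>DIM('a). real l)"
    \<comment> \<open>\<open>gap i\<close> is an involution of the indices.\<close>
    by (rule sum.reindex_bij_witness[of _ "gap i" "gap i"]) (use i gap_gap gap_le in auto)
  also have "\<dots> = real DIM('a) * real (Suc DIM('a)) / 2"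
    using double_gauss_sum[of "DIM('a)", where 'a=real] by (simp add: atLeast0AtMost algebra_simps)
  finally show "(\<Sum>l\<le>DIM('a). 2 * real (gap i l) / (real DIM('a) * real (Suc DIM('a)))) = 1"
    by (simp flip: sum_divide_distrib sum_distrib_left)
qed

lemma orbit_point_in_rel_interior:
  assumes "i \<le> DIM('a)" shows "orbit_point i \<in> rel_interior (face w i)"
  using assms gap_pos[of _ i] by (simp add: in_rel_interior_face_iff bary_orbit_point gap_self)

lemma proj_orbit_point:
  assumes i: "i \<le> DIM('a)"
  shows "proj (cyc i) (orbit_point i) = orbit_point (cyc i)"
proof (rule bary_eqI)
  fix l assume l: "l \<le> DIM('a)"
  have "gap i (cyc i) = DIM('a)" using i by (auto simp: gap_def cyc_def)
  moreover have "2 * real DIM('a) / (real DIM('a) * real (Suc DIM('a))) / real DIM('a)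
      = 2 / (real DIM('a) * real (Suc DIM('a)))" by simp
  ultimately show "bary l (proj (cyc i) (orbit_point i)) = bary l (orbit_point (cyc i))"
    using l i cyc_le[OF i]
    by (simp add: bary_proj bary_orbit_point gap_cyc del: of_nat_Suc)
      (simp add: add_divide_distrib mult.commute)
qed

lemma blin_cyclic_field:
  assumes "i \<le> DIM('a)" "j \<le> DIM('a)"
  shows "blin j (cyclic_field i) = (if j = cyc i then - 1 else 1 / real DIM('a)) / sqrt (height_sq DIM('a))"
  using assms cyc_le[OF assms(1)]
  by (simp add: cyclic_field_def blin_minus face_normal_eq blin_scaleR blin_altitude)

lemma blin_cyclic_field_pos_iff:
  assumes "i \<le> DIM('a)" "j \<le> DIM('a)"
  shows "0 < blin j (cyclic_field i) \<longleftrightarrow> j \<noteq> cyc i"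
  unfolding blin_cyclic_field[OF assms] using height_pos by (simp add: zero_less_divide_iff)

section \<open>The return map of the cyclic billiard\<close>

lemma standard_model_cyclic_field: "standard_model w cyclic_field"
  unfolding standard_model_def
proof (intro conjI allI impI ballI)
  show "\<not> affine_dependent (w ` {..DIM('a)})" by (rule affine_independent_vertices)
  fix i assume i: "i \<le> DIM('a)"
  show "dist (w i) (w j) = 1" if "j \<le> DIM('a)" "i \<noteq> j" for j
    by (rule unit_dist[OF i that])
  show "norm (cyclic_field i) = 1"
    using cyc_le[OF i] height_pos by (simp add: cyclic_field_def face_normal_eq norm_altitude)
  fix x assume "x \<in> rel_interior (face w i)"
  then have x: "bary i x = 0" "\<forall>j\<le>DIM('a). j \<noteq> i \<longrightarrow> 0 < bary j x"
    using i by (simp_all add: in_rel_interior_face_iff)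
  then have "\<forall>j\<le>DIM('a). 0 \<le> bary j x" by (metis less_eq_real_def)
  moreover have "0 < blin j (cyclic_field i)" if "j \<le> DIM('a)" "bary j x = 0" for j
  proof -
    have "j = i" using x that by fastforce
    then show ?thesis using blin_cyclic_field_pos_iff[OF i i] cyc_neq[of i] by auto
  qed
  ultimately show "directed_into w x (cyclic_field i)" by (simp add: directed_into_iff)
qed

text \<open>The vector of face 0 changes coordinates 0 and 2 at the same rate, both being different
  from \<open>cyc 0 = 1\<close>. The vertex condition would need one to fall from 1 to 0 while the
  other rises from 0. The third index requires \<open>d \<ge> 2\<close>.\<close>

lemma not_vertex_line_condition_cyclic_field:
  assumes "DIM('a) \<ge> 2" shows "\<not> vertex_line_condition w cyclic_field"
proof
  assume "vertex_line_condition w cyclic_field"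
  then obtain s where "w 0 + s *\<^sub>R cyclic_field 0 \<in> rel_interior (face w 0)"
    unfolding vertex_line_condition_def by blast
  then have *: "bary 0 (w 0 + s *\<^sub>R cyclic_field 0) = 0" "0 < bary 2 (w 0 + s *\<^sub>R cyclic_field 0)"
    using assms by (simp_all add: in_rel_interior_face_iff)
  have "cyc 0 = 1" by (simp add: cyc_def)
  then have "blin 0 (cyclic_field 0) = blin 2 (cyclic_field 0)"
    using assms by (simp add: blin_cyclic_field)
  with * show False using assms by (simp add: bary_add blin_scaleR bary_vertex)
qed

lemma cyclic_available_iff:
  assumes "x \<in> faces_union w"
  shows "i \<in> available_faces w cyclic_field x \<longleftrightarrow> i \<le> DIM('a) \<and> bary i x = 0 \<and> bary (cyc i) x \<noteq> 0"
  unfolding available_faces_iff[OF assms]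
  using blin_cyclic_field_pos_iff cyc_le by blast

text \<open>Without an available face, each vanishing coordinate forces the next one to vanish;
  around the cycle all would be 0, although they sum to 1.\<close>

lemma cyclic_available_nonempty:
  assumes x: "x \<in> faces_union w"
  shows "available_faces w cyclic_field x \<noteq> {}"
proof
  assume "available_faces w cyclic_field x = {}"
  then have step: "bary i x = 0 \<Longrightarrow> bary (cyc i) x = 0" if "i \<le> DIM('a)" for i
    using cyclic_available_iff[OF x, of i] that by auto
  obtain i where i: "i \<le> DIM('a)" "bary i x = 0" using x by (auto simp: in_faces_union_iff)
  have "bary ((cyc ^^ m) i) x = 0" for m
    by (induction m) (use i step funpow_cyc_le in auto)
  then have "bary l x = 0" if "l \<le> DIM('a)" for l
    using funpow_cyc_reaches[OF i(1) that] by metis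
  then show False using sum_bary[of x] by simp
qed

text \<open>Every coordinate other than \<open>j\<close> gains a positive share of coordinate
  \<open>j\<close>. Hence a single step moves any point, even one on several faces, into the
  relative interior of a face.\<close>

lemma proj_in_rel_interior:
  assumes x: "x \<in> faces_union w" and j: "j \<le> DIM('a)" "bary j x \<noteq> 0"
  shows "proj j x \<in> rel_interior (face w j)"
proof -
  have nonneg: "0 \<le> bary l x" if "l \<le> DIM('a)" for l using x that by (simp add: in_faces_union_iff)
  then have "0 < bary j x" using j by (metis less_eq_real_def)
  then show ?thesis
    using j nonneg by (auto simp: in_rel_interior_face_iff bary_proj intro!: add_nonneg_pos)
qed

lemma T_cases:
  assumes x: "x \<in> faces_union w"
  obtains i where "i \<in> available_faces w cyclic_field x" "T x = proj (cyc i) x"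
    "T x \<in> rel_interior (face w (cyc i))"
proof -
  define i where "i = (LEAST i. i \<in> available_faces w cyclic_field x)"
  have av: "i \<in> available_faces w cyclic_field x"
    unfolding i_def using cyclic_available_nonempty[OF x] by (metis LeastI_ex ex_in_conv)
  then have i: "i \<le> DIM('a)" "bary i x = 0" "bary (cyc i) x \<noteq> 0"
    using cyclic_available_iff[OF x] by auto
  let ?h = "sqrt (height_sq DIM('a))" and ?j = "cyc i"
  have h: "?h > 0" using height_pos by simp
  have j: "?j \<le> DIM('a)" using cyc_le[OF i(1)] .
  have nonneg: "0 \<le> bary l x" if "l \<le> DIM('a)" for l using x that by (simp add: in_faces_union_iff)
  then have pos: "0 < bary ?j x" using j i(3) by (metis less_eq_real_def)
  \<comment> \<open>Coordinate \<open>cyc i\<close> falls at rate \<open>1 / ?h\<close>, which gives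
    the time \<open>bary ?j x * ?h\<close>.\<close>
  have move: "x + (bary ?j x * ?h) *\<^sub>R cyclic_field i = proj ?j x"
    using h j by (simp add: cyclic_field_def face_normal_eq proj_def)
  have ri: "proj ?j x \<in> rel_interior (face w ?j)" by (rule proj_in_rel_interior[OF x j i(3)])
  have ft: "flight_time w x (cyclic_field i) = bary ?j x * ?h"
  proof (rule flight_timeI)
    show "0 < bary ?j x * ?h" using pos h by simp
    show "x + (bary ?j x * ?h) *\<^sub>R cyclic_field i \<in> faces_union w"
      unfolding move faces_union_def using ri rel_interior_subset j by blast
    fix s :: real assume s: "0 < s" "x + s *\<^sub>R cyclic_field i \<in> faces_union w"
    then obtain k where k: "k \<le> DIM('a)" "bary k (x + s *\<^sub>R cyclic_field i) = 0"
      by (auto simp: in_faces_union_iff)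
    \<comment> \<open>All other coordinates strictly increase along the flight, so only face
      \<open>cyc i\<close> can be met.\<close>
    have "k = ?j"
    proof (rule ccontr)
      assume "k \<noteq> ?j"
      then have "0 < s * blin k (cyclic_field i)" using s blin_cyclic_field_pos_iff[OF i(1) k(1)] by simp
      then show False using k nonneg[OF k(1)] by (simp add: bary_add blin_scaleR)
    qed
    then show "s = bary ?j x * ?h"
      using k h i(1) by (simp add: bary_add blin_scaleR blin_cyclic_field field_simps)
  qed
  have "T x = proj ?j x"
    using cyclic_available_nonempty[OF x] ft move by (simp add: return_map_def velocity_def flip: i_def)
  then show ?thesis using that av ri by simp
qed

lemma T_rel_interior:
  assumes i: "i \<le> DIM('a)" and x: "x \<in> rel_interior (face w i)"
  shows "T x = proj (cyc i) x" "T x \<in> rel_interior (face w (cyc i))"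
proof -
  have xf: "x \<in> faces_union w" unfolding faces_union_def using x i rel_interior_subset by blast
  obtain k where k: "k \<in> available_faces w cyclic_field x" "T x = proj (cyc k) x"
    "T x \<in> rel_interior (face w (cyc k))"
    using T_cases[OF xf] .
  have "k = i"
    using k(1) x i unfolding cyclic_available_iff[OF xf] in_rel_interior_face_iff[OF i] by fastforce
  then show "T x = proj (cyc i) x" "T x \<in> rel_interior (face w (cyc i))" using k by auto
qed

lemma T_orbit_point:
  assumes "i \<le> DIM('a)" shows "T (orbit_point i) = orbit_point (cyc i)"
  using T_rel_interior(1)[OF assms orbit_point_in_rel_interior[OF assms]] proj_orbit_point[OF assms] by simp

lemma funpow_T_orbit_point:
  assumes "i \<le> DIM('a)" shows "(T ^^ k) (orbit_point i) = orbit_point ((cyc ^^ k) i)"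
  by (induction k) (simp_all add: T_orbit_point funpow_cyc_le assms)

lemma funpow_T_rel_interior:
  assumes "i \<le> DIM('a)" "x \<in> rel_interior (face w i)"
  shows "(T ^^ k) x \<in> rel_interior (face w ((cyc ^^ k) i))"
  by (induction k) (use assms T_rel_interior(2) funpow_cyc_le in auto)

text \<open>Pythagoras: the projection removes from \<open>x - y\<close> its component along
  \<open>altitude i\<close>, whose squared length is the subtracted term.\<close>

lemma norm_proj_diff:
  assumes "i \<le> DIM('a)"
  shows "(norm (proj i x - proj i y))\<^sup>2 = (norm (x - y))\<^sup>2 - height_sq DIM('a) * (bary i x - bary i y)\<^sup>2"
proof -
  define e where "e = x - y"
  let ?b = "blin i e"
  have e: "e \<bullet> altitude i = ?b * height_sq DIM('a)" using height_pos by (simp add: blin_def)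
  have "proj i x - proj i y = e - ?b *\<^sub>R altitude i"
    by (simp add: proj_def e_def blin_eq_bary_diff algebra_simps)
  moreover have "(e - ?b *\<^sub>R altitude i) \<bullet> (e - ?b *\<^sub>R altitude i) = e \<bullet> e - height_sq DIM('a) * ?b\<^sup>2"
    using e e[unfolded inner_commute[of e]] inner_altitude_self[OF assms]
    by (simp add: inner_diff_left inner_diff_right power2_eq_square)
  ultimately have "(norm (proj i x - proj i y))\<^sup>2 = (norm (x - y))\<^sup>2 - height_sq DIM('a) * ?b\<^sup>2"
    by (simp add: power2_norm_eq_inner flip: e_def)
  then have "(norm (proj i x - proj i y))\<^sup>2 = (norm (x - y))\<^sup>2 - height_sq DIM('a) * (blin i (x - y))\<^sup>2"
    by (simp add: e_def)
  then show ?thesis by (simp add: blin_eq_bary_diff)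
qed

lemma dist_le_bary_diff: "dist x y \<le> (\<Sum>l\<le>DIM('a). \<bar>bary l x - bary l y\<bar> * norm (w l))"
proof -
  have "x - y = (\<Sum>l\<le>DIM('a). (bary l x - bary l y) *\<^sub>R w l)"
    by (simp add: scaleR_diff_left sum_subtractf bary_repr)
  then show ?thesis
    unfolding dist_norm by (metis (mono_tags, lifting) norm_scaleR norm_sum real_norm_def sum.cong)
qed

section \<open>Convergence to the orbit from a relative interior\<close>

context
  fixes i0 x0
  assumes i0: "i0 \<le> DIM('a)" and x0: "x0 \<in> rel_interior (face w i0)"
begin

text \<open>The return map is the orthogonal projection to the next face, so distances to the
  orbit shrink by exactly the normal component.\<close>
lemma dist_orbit_step:
  "(dist ((T ^^ Suc k) x0) (orbit_point ((cyc ^^ Suc k) i0)))\<^sup>2 =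
   (dist ((T ^^ k) x0) (orbit_point ((cyc ^^ k) i0)))\<^sup>2 - height_sq DIM('a) *
     (bary (cyc ((cyc ^^ k) i0)) ((T ^^ k) x0) - bary (cyc ((cyc ^^ k) i0)) (orbit_point ((cyc ^^ k) i0)))\<^sup>2"
proof -
  let ?i = "(cyc ^^ k) i0"
  have i: "?i \<le> DIM('a)" by (rule funpow_cyc_le[OF i0])
  have "T ((T ^^ k) x0) = proj (cyc ?i) ((T ^^ k) x0)"
    by (rule T_rel_interior(1)[OF i funpow_T_rel_interior[OF i0 x0]])
  moreover have "orbit_point (cyc ?i) = proj (cyc ?i) (orbit_point ?i)"
    by (rule proj_orbit_point[OF i, symmetric])
  ultimately show ?thesis
    by (simp add: dist_norm norm_proj_diff[OF cyc_le[OF i]])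
qed

lemma dist_orbit_decreasing:
  "dist ((T ^^ k) x0) (orbit_point ((cyc ^^ k) i0)) \<le> dist x0 (orbit_point i0)"
proof (induction k)
  case (Suc k)
  have "(dist ((T ^^ Suc k) x0) (orbit_point ((cyc ^^ Suc k) i0)))\<^sup>2
      \<le> (dist ((T ^^ k) x0) (orbit_point ((cyc ^^ k) i0)))\<^sup>2"
    unfolding dist_orbit_step using height_pos by (simp add: less_imp_le)
  then have "dist ((T ^^ Suc k) x0) (orbit_point ((cyc ^^ Suc k) i0)) \<le> dist ((T ^^ k) x0) (orbit_point ((cyc ^^ k) i0))"
    by (rule power2_le_imp_le) simp
  with Suc show ?case by linarith
qed simp

lemma bary_next_tendsto:
  "(\<lambda>k. bary (cyc ((cyc ^^ k) i0)) ((T ^^ k) x0)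
      - bary (cyc ((cyc ^^ k) i0)) (orbit_point ((cyc ^^ k) i0))) \<longlonglongrightarrow> 0" (is "?g \<longlonglongrightarrow> 0")
proof -
  define E where "E k = (dist ((T ^^ k) x0) (orbit_point ((cyc ^^ k) i0)))\<^sup>2" for k
  have E: "E (Suc k) = E k - height_sq DIM('a) * (?g k)\<^sup>2" for k
    unfolding E_def by (rule dist_orbit_step)
  have "decseq E" using height_pos by (intro decseq_SucI) (simp add: E less_imp_le)
  moreover have "0 \<le> E k" for k by (simp add: E_def)
  ultimately obtain L where L: "E \<longlonglongrightarrow> L" using decseq_convergent by metis
  then have "(\<lambda>k. sqrt ((E k - E (Suc k)) / height_sq DIM('a))) \<longlonglongrightarrow> sqrt ((L - L) / height_sq DIM('a))"
    using height_pos by (intro tendsto_intros LIMSEQ_Suc) auto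
  moreover have "(\<lambda>k. sqrt ((E k - E (Suc k)) / height_sq DIM('a))) = (\<lambda>k. \<bar>?g k\<bar>)"
    using height_pos by (simp add: E)
  ultimately show ?thesis by (simp add: tendsto_rabs_zero_iff)
qed

text \<open>The coordinate \<open>m + 2\<close> steps ahead at time \<open>k\<close> is
  \<open>m + 1\<close> steps ahead at time \<open>k + 1\<close>. The step in between adds only
  \<open>1 / d\<close> of the coordinate being removed, whose error tends to 0 by
  \<open>bary_next_tendsto\<close>.\<close>

lemma bary_orbit_tendsto:
  "(\<lambda>k. bary ((cyc ^^ Suc m) ((cyc ^^ k) i0)) ((T ^^ k) x0)
      - bary ((cyc ^^ Suc m) ((cyc ^^ k) i0)) (orbit_point ((cyc ^^ k) i0))) \<longlonglongrightarrow> 0"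
proof (induction m)
  case 0
  show ?case using bary_next_tendsto by simp
next
  case (Suc m)
  let ?i = "\<lambda>k. (cyc ^^ k) i0"
  let ?g = "\<lambda>m k. bary ((cyc ^^ m) (?i k)) ((T ^^ k) x0) - bary ((cyc ^^ m) (?i k)) (orbit_point (?i k))"
  have bound: "\<bar>?g (Suc (Suc m)) k\<bar> \<le> \<bar>?g (Suc m) (Suc k)\<bar> + \<bar>?g (Suc 0) k\<bar>" for k
  proof -
    let ?j = "(cyc ^^ Suc m) (?i (Suc k))"
    have i: "?i k \<le> DIM('a)" by (rule funpow_cyc_le[OF i0])
    have j: "?j \<le> DIM('a)" by (intro funpow_cyc_le i0)
    have jk: "(cyc ^^ Suc (Suc m)) (?i k) = ?j" by (simp add: funpow_swap1)
    show ?thesis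
    \<comment> \<open>If the indices have run once around the cycle, the coordinate is the one being
      removed, and the bound is trivial.\<close>
    proof (cases "?j = cyc (?i k)")
      case True
      then show ?thesis unfolding jk by simp
    next
      case False
      have "T ((T ^^ k) x0) = proj (cyc (?i k)) ((T ^^ k) x0)"
        by (rule T_rel_interior(1)[OF i funpow_T_rel_interior[OF i0 x0]])
      then have "bary ?j ((T ^^ Suc k) x0) = bary ?j ((T ^^ k) x0) + bary (cyc (?i k)) ((T ^^ k) x0) / real DIM('a)"
        using False bary_proj[OF cyc_le[OF i] j] by simp
      moreover have "bary ?j (orbit_point (?i (Suc k)))
          = bary ?j (orbit_point (?i k)) + bary (cyc (?i k)) (orbit_point (?i k)) / real DIM('a)"
        using False bary_proj[OF cyc_le[OF i] j, of "orbit_point (?i k)"] proj_orbit_point[OF i] by simp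
      ultimately have "?g (Suc (Suc m)) k = ?g (Suc m) (Suc k) - ?g (Suc 0) k / real DIM('a)"
        unfolding jk by (simp add: diff_divide_distrib)
      moreover have "\<bar>?g (Suc 0) k / real DIM('a)\<bar> \<le> \<bar>?g (Suc 0) k\<bar>"
        by (simp add: divide_le_eq mult_le_cancel_left1 Suc_le_eq)
      ultimately show ?thesis by linarith
    qed
  qed
  have "(\<lambda>k. \<bar>?g (Suc m) (Suc k)\<bar> + \<bar>?g (Suc 0) k\<bar>) \<longlonglongrightarrow> \<bar>0\<bar> + \<bar>0\<bar>"
    by (intro tendsto_intros LIMSEQ_Suc[OF Suc.IH]) (use bary_next_tendsto in simp)
  then have lim: "(\<lambda>k. \<bar>?g (Suc m) (Suc k)\<bar> + \<bar>?g (Suc 0) k\<bar>) \<longlonglongrightarrow> 0" by simp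
  show ?case
  proof (rule Lim_null_comparison[OF always_eventually lim], rule allI)
    show "norm (?g (Suc (Suc m)) k) \<le> \<bar>?g (Suc m) (Suc k)\<bar> + \<bar>?g (Suc 0) k\<bar>" for k
      unfolding real_norm_def by (rule bound)
  qed
qed

lemma dist_orbit_tendsto: "(\<lambda>k. dist ((T ^^ k) x0) (orbit_point ((cyc ^^ k) i0))) \<longlonglongrightarrow> 0"
proof -
  define i where "i k = (cyc ^^ k) i0" for k
  define e where "e l k = bary l ((T ^^ k) x0) - bary l (orbit_point (i k))" for l k
  define g where "g m k = \<bar>e ((cyc ^^ m) (i k)) k\<bar>" for m k
  have i_le: "i k \<le> DIM('a)" for k unfolding i_def by (rule funpow_cyc_le[OF i0])
  have "g m \<longlonglongrightarrow> 0" if m: "m \<in> {1..Suc DIM('a)}" for m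
  proof -
    obtain m' where "m = Suc m'" using m by (cases m) auto
    then show ?thesis
      using bary_orbit_tendsto[of m'] unfolding g_def e_def i_def by (simp only: tendsto_rabs_zero_iff)
  qed
  \<comment> \<open>The number of steps from \<open>i k\<close> to a fixed \<open>l\<close> varies
    with \<open>k\<close>; the sum over a full turn bounds the error of coordinate \<open>l\<close>
    for every \<open>k\<close>.\<close>
  then have G: "(\<lambda>k. \<Sum>m\<in>{1..Suc DIM('a)}. g m k) \<longlonglongrightarrow> 0" by (rule tendsto_null_sum)
  have "e l \<longlonglongrightarrow> 0" if l: "l \<le> DIM('a)" for l
  proof (rule Lim_null_comparison[OF always_eventually G], rule allI)
    fix k
    obtain m where m: "m \<in> {1..Suc DIM('a)}" "(cyc ^^ m) (i k) = l"
      by (rule funpow_cyc_reaches[OF i_le l])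
    then have "norm (e l k) = g m k" by (simp add: g_def)
    also have "\<dots> \<le> (\<Sum>m\<in>{1..Suc DIM('a)}. g m k)"
      using m(1) by (intro member_le_sum) (auto simp: g_def)
    finally show "norm (e l k) \<le> (\<Sum>m\<in>{1..Suc DIM('a)}. g m k)" .
  qed
  then have B: "(\<lambda>k. \<Sum>l\<le>DIM('a). \<bar>e l k\<bar> * norm (w l)) \<longlonglongrightarrow> 0"
    by (intro tendsto_null_sum tendsto_mult_left_zero) (simp add: tendsto_rabs_zero_iff)
  show ?thesis
  proof (rule Lim_null_comparison[OF always_eventually B], rule allI)
    show "norm (dist ((T ^^ k) x0) (orbit_point ((cyc ^^ k) i0))) \<le> (\<Sum>l\<le>DIM('a). \<bar>e l k\<bar> * norm (w l))" for k
      using dist_le_bary_diff[of "(T ^^ k) x0" "orbit_point (i k)"] by (simp add: e_def i_def)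
  qed
qed

end

section \<open>Attraction and stability of the orbit\<close>

definition orbit :: "'a set" where
  "orbit = orbit_point ` {..DIM('a)}"

lemma infdist_orbit_le:
  assumes "i \<le> DIM('a)" shows "infdist x orbit \<le> dist x (orbit_point i)"
  using assms by (intro infdist_le) (auto simp: orbit_def)

lemma orbit_attracts:
  assumes x: "x \<in> faces_union w"
  shows "(\<lambda>k. infdist ((T ^^ k) x) orbit) \<longlonglongrightarrow> 0"
proof -
  \<comment> \<open>The starting point may lie on several faces; after one step the convergence
    result applies, and an index shift does not affect the limit.\<close>
  obtain i where "i \<in> available_faces w cyclic_field x" and ri: "T x \<in> rel_interior (face w (cyc i))"
    using T_cases[OF x] .
  then have i: "cyc i \<le> DIM('a)" using cyclic_available_iff[OF x] cyc_le by auto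
  have "(\<lambda>k. infdist ((T ^^ k) (T x)) orbit) \<longlonglongrightarrow> 0"
  proof (rule Lim_null_comparison[OF always_eventually dist_orbit_tendsto[OF i ri]], rule allI)
    show "norm (infdist ((T ^^ k) (T x)) orbit) \<le> dist ((T ^^ k) (T x)) (orbit_point ((cyc ^^ k) (cyc i)))" for k
      using infdist_orbit_le[OF funpow_cyc_le[OF i]] by (simp add: infdist_nonneg)
  qed
  then have "(\<lambda>k. infdist ((T ^^ Suc k) x) orbit) \<longlonglongrightarrow> 0" by (simp add: funpow_swap1)
  then show ?thesis by (rule LIMSEQ_imp_Suc)
qed

text \<open>All coordinates but the \<open>i\<close>-th are positive at
  \<open>orbit_point i\<close>, hence also nearby, where only face \<open>i\<close> remains
  possible. Stability needs this because \<open>dist_orbit_decreasing\<close> compares points that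
  start on the same face.\<close>

lemma near_orbit_point:
  assumes i: "i \<le> DIM('a)"
  shows "\<exists>r>0. \<forall>x\<in>faces_union w. dist x (orbit_point i) < r \<longrightarrow> x \<in> rel_interior (face w i)"
proof -
  let ?U = "\<Inter>l\<in>{..DIM('a)} - {i}. {x. 0 < bary l x}"
  have "open ?U" by (intro open_INT ballI open_Collect_less continuous_intros) auto
  moreover have "orbit_point i \<in> ?U"
    using orbit_point_in_rel_interior[OF i] i by (auto simp: in_rel_interior_face_iff)
  ultimately obtain r where r: "r > 0" "ball (orbit_point i) r \<subseteq> ?U"
    using open_contains_ball by blast
  have "x \<in> rel_interior (face w i)" if x: "x \<in> faces_union w" "dist x (orbit_point i) < r" for x
  proof -
    have "x \<in> ?U" using x r by (auto simp: dist_commute)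
    then have pos: "0 < bary l x" if "l \<le> DIM('a)" "l \<noteq> i" for l using that by auto
    obtain k where "k \<le> DIM('a)" "bary k x = 0" using x by (auto simp: in_faces_union_iff)
    then have "bary i x = 0" using pos[of k] by fastforce
    then show ?thesis using pos i by (simp add: in_rel_interior_face_iff)
  qed
  then show ?thesis using r by blast
qed

lemma orbit_stable:
  assumes "\<epsilon> > 0"
  shows "\<exists>\<delta>>0. \<forall>x\<in>faces_union w. infdist x orbit < \<delta> \<longrightarrow> (\<forall>k. infdist ((T ^^ k) x) orbit < \<epsilon>)"
proof -
  obtain r where r: "\<And>i. i \<le> DIM('a) \<Longrightarrow> 0 < r i"
    "\<And>i x. i \<le> DIM('a) \<Longrightarrow> x \<in> faces_union w \<Longrightarrow> dist x (orbit_point i) < r i \<Longrightarrow> x \<in> rel_interior (face w i)"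
    using near_orbit_point by metis
  \<comment> \<open>Below every \<open>r i\<close> the nearby point shares the face of its orbit
    point; from then on the distance to the moving orbit point never grows, so
    \<open>\<delta> \<le> \<epsilon>\<close> suffices.\<close>
  define \<delta> where "\<delta> = Min (insert \<epsilon> (r ` {..DIM('a)}))"
  have \<delta>: "\<delta> > 0" "\<delta> \<le> \<epsilon>" "\<And>i. i \<le> DIM('a) \<Longrightarrow> \<delta> \<le> r i"
    using assms r(1) by (auto simp del: Min_insert simp: \<delta>_def intro!: Min_le)
  have "infdist ((T ^^ k) x) orbit < \<epsilon>" if x: "x \<in> faces_union w" "infdist x orbit < \<delta>" for x k
  proof -
    have "closed orbit" "orbit \<noteq> {}" by (auto simp: orbit_def intro!: finite_imp_closed)
    then obtain p where "p \<in> orbit" "infdist x orbit = dist x p" by (rule infdist_attains_inf)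
    then obtain i where i: "i \<le> DIM('a)" "dist x (orbit_point i) < \<delta>" using x by (auto simp: orbit_def)
    then have "x \<in> rel_interior (face w i)" using r(2)[OF i(1) x(1)] \<delta>(3)[OF i(1)] by simp
    from dist_orbit_decreasing[OF i(1) this, of k]
    show ?thesis using infdist_orbit_le[OF funpow_cyc_le[OF i(1)], of "(T ^^ k) x" k] i(2) \<delta>(2) by linarith
  qed
  then show ?thesis using \<delta>(1) by blast
qed

lemma orbit_globally_stable: "globally_stable_periodic_orbit w cyclic_field orbit"
  unfolding globally_stable_periodic_orbit_def
proof (intro conjI bexI exI)
  show "1 \<le> Suc DIM('a)" by simp
  have face_in: "orbit_point i \<in> faces_union w" if "i \<le> DIM('a)" for i
    unfolding faces_union_def using orbit_point_in_rel_interior[OF that] rel_interior_subset that by blast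
  show "orbit_point 0 \<in> faces_union w" by (rule face_in) simp
  show "(T ^^ Suc DIM('a)) (orbit_point 0) = orbit_point 0"
    unfolding funpow_T_orbit_point[OF le0] by (subst funpow_cyc) simp_all
  have "(T ^^ k) (orbit_point 0) = orbit_point k" if "k \<le> DIM('a)" for k
    unfolding funpow_T_orbit_point[OF le0] using that by (subst funpow_cyc) simp_all
  then show "orbit = (\<lambda>k. (T ^^ k) (orbit_point 0)) ` {..<Suc DIM('a)}"
    unfolding orbit_def lessThan_Suc_atMost by (intro image_cong) auto
  show "\<forall>p\<in>orbit. available_faces w cyclic_field p \<noteq> {}"
    using cyclic_available_nonempty face_in by (auto simp: orbit_def)
  show "\<forall>\<epsilon>>0. \<exists>\<delta>>0. \<forall>x\<in>faces_union w. infdist x orbit < \<delta> \<longrightarrow> (\<forall>k. infdist ((T ^^ k) x) orbit < \<epsilon>)"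
    using orbit_stable by blast
  show "\<forall>x\<in>faces_union w. (\<lambda>k. infdist ((T ^^ k) x) orbit) \<longlonglongrightarrow> 0"
    using orbit_attracts by blast
qed

end

theorem theorem2p5:
  "(\<forall>w v :: nat \<Rightarrow> 'a::euclidean_space.
      standard_model w v \<and> vertex_line_condition w v \<longrightarrow> strongly_chaotic w v) \<and>
   (DIM('a) \<ge> 2 \<longrightarrow>
      (\<exists>w v :: nat \<Rightarrow> 'a.
         standard_model w v \<and> \<not> vertex_line_condition w v \<and>
         (\<exists>P. globally_stable_periodic_orbit w v P)))"
proof (intro conjI allI impI)
  fix w v :: "nat \<Rightarrow> 'a"
  assume "standard_model w v \<and> vertex_line_condition w v"
  then interpret radial_billiard w v by (simp add: radial_billiardI)
  show "strongly_chaotic w v" by (rule radial_billiard_strongly_chaotic)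
next
  assume dim: "DIM('a) \<ge> 2"
  obtain w :: "nat \<Rightarrow> 'a" where "equilateral_simplex w" using exists_equilateral_simplex by blast
  then interpret equilateral_simplex w .
  show "\<exists>w v :: nat \<Rightarrow> 'a. standard_model w v \<and> \<not> vertex_line_condition w v \<and>
      (\<exists>P. globally_stable_periodic_orbit w v P)"
    using standard_model_cyclic_field not_vertex_line_condition_cyclic_field[OF dim] orbit_globally_stable
    by blast
qed

end
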